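(* Let $S$ be an invariant surface in Sol with constant extrinsic Gaussian curvature $K_{ext}=c$, with maximal generating curve $\alpha$. Up to integration constants, we have the following classification: (1) If $c=0$, then $S$ is a leaf of $\mathcal{F}_2$, or the generating curve of $S$ is $$\alpha(s)=\big(0,\ \tanh(s),\ -\log(\cosh(s))\big).$$ (2) If $c=-1$, then $S$ is a leaf of $\mathcal{F}_3$, or $$\alpha(s)=\Big(0,\ -\frac{\sqrt{s^2-1}}{s}+\log(s+\sqrt{s^2-1}),\ -\log(s)\Big),\qquad s>1.$$ (3) If $c\in(-1,0)$, then $\alpha$ is the graph $z(y)=\log(y)$ (that is, $z(y)=\log(ay)$ for some constant $a\neq 0$); or $\alpha$ is the graph of a function $z(y)$ defined on a bounded interval $(-M,M)\subset\mathbb{R}$ and it is asymptotic to the vertical lines $y=\pm M$; or $\alpha$ is the graph of a function $z(y)$ defined on a bounded interval $(m,M)$ and it is asymptotic to the vertical line $y=m$. (4) If $c>0$ or $c<-1$, then $\alpha$ is the graph of a function $z(y)$ defined on a bounded interval $(a_0,b_0)$ with a single maximum or minimum; it is bounded and it is vertical at the end points of $(a_0,b_0)$ (i.e. the tangent direction of $\alpha$ tends to the $z$-direction there).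
   Context: Sol is $\mathbb{R}^3$ with the Riemannian metric $e^{2z}dx^2+e^{-2z}dy^2+dz^2$. An orthonormal frame is $E_1=e^{-z}\partial_x$, $E_2=e^{z}\partial_y$, $E_3=\partial_z$. An invariant surface is a surface invariant under the one-parameter group of isometries $T_{1,c}(x,y,z)=(x+c,y,z)$, $c\in\mathbb{R}$. It is parametrized by $X(s,t)=(t,y(s),z(s))$, $s\in I$ (an open interval), $t\in\mathbb{R}$, where $\alpha(s)=(0,y(s),z(s))$ is the generating curve, parametrized by arc length: $y'=e^{z}\cos\theta$, $z'=\sin\theta$ for a smooth angle function $\theta=\theta(s)$. $K_{ext}$ is the product of the two principal curvatures of $S$ in Sol (the determinant of the second fundamental form relative to the first); for an invariant surface $K_{ext}=-\cos\theta(\theta'+\cos\theta)$. The foliations are $\mathcal{F}_2=\{Q_t\}_{t\in\mathbb{R}}$, $Q_t=\{(x,t,z):x,z\in\mathbb{R}\}$, and $\mathcal{F}_3=\{R_t\}_{t\in\mathbb{R}}$, $R_t=\{(x,y,t):x,y\in\mathbb{R}\}$. The generating curve is maximal: $(y,z,\theta)$ is a smooth solution, on its maximal open interval of existence, of the ODE system given by $y'=e^z\cos\theta$, $z'=\sin\theta$ and the curvature condition. A graph is asymptotic to the vertical line $y=y_0$ if $|z(y)|\to\infty$ as $y\to y_0$. "Up to integration constants" means: up to reparametrizations $s\mapsto\pm s+s_0$ of $\alpha$ and up to the isometries of Sol $(x,y,z)\mapsto(x,y+b,z)$, $(x,y,z)\mapsto(e^{\lambda}x,e^{-\lambda}y,z-\lambda)$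 and $(x,y,z)\mapsto(x,-y,z)$. *)

theory Defs
  imports "HOL-Analysis.Analysis"
begin

definition sol_metric :: "real^3 \<Rightarrow> real^3 \<Rightarrow> real^3 \<Rightarrow> real" where
  "sol_metric p u v = exp (2 * p$3) * u$1 * v$1 + exp (- 2 * p$3) * u$2 * v$2 + u$3 * v$3"

definition sol_metric_matrix :: "real^3 \<Rightarrow> real^3^3" where
  "sol_metric_matrix p = (\<chi> i j. sol_metric p (axis i 1) (axis j 1))"

definition partial_deriv :: "3 \<Rightarrow> (real^3 \<Rightarrow> real) \<Rightarrow> real^3 \<Rightarrow> real" where
  "partial_deriv i f p = deriv (\<lambda>h. f (p + h *\<^sub>R axis i 1)) 0"

text \<open>Christoffel symbols of the Levi-Civita connection; the first index argument is the upper one.\<close>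

definition sol_christoffel :: "real^3 \<Rightarrow> 3 \<Rightarrow> 3 \<Rightarrow> 3 \<Rightarrow> real" where
  "sol_christoffel p k i j = 1/2 * (\<Sum>l\<in>UNIV. matrix_inv (sol_metric_matrix p) $ k $ l *
      (partial_deriv i (\<lambda>q. sol_metric_matrix q $ j $ l) p
       + partial_deriv j (\<lambda>q. sol_metric_matrix q $ i $ l) p
       - partial_deriv l (\<lambda>q. sol_metric_matrix q $ i $ j) p))"

definition sol_covariant_deriv :: "(real \<Rightarrow> real^3) \<Rightarrow> (real \<Rightarrow> real^3) \<Rightarrow> real \<Rightarrow> real^3" where
  "sol_covariant_deriv \<gamma> V r = vector_derivative V (at r) +
     (\<chi> k. \<Sum>i\<in>UNIV. \<Sum>j\<in>UNIV.
        sol_christoffel (\<gamma> r) k i j * vector_derivative \<gamma> (at r) $ i * V r $ j)"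

definition deriv_s :: "(real \<Rightarrow> real \<Rightarrow> real^3) \<Rightarrow> real \<Rightarrow> real \<Rightarrow> real^3" where
  "deriv_s X s t = vector_derivative (\<lambda>r. X r t) (at s)"

definition deriv_t :: "(real \<Rightarrow> real \<Rightarrow> real^3) \<Rightarrow> real \<Rightarrow> real \<Rightarrow> real^3" where
  "deriv_t X s t = vector_derivative (X s) (at t)"

definition sol_unit_normal :: "(real \<Rightarrow> real \<Rightarrow> real^3) \<Rightarrow> real \<Rightarrow> real \<Rightarrow> real^3 \<Rightarrow> bool" where
  "sol_unit_normal X s t n \<longleftrightarrow>
     sol_metric (X s t) n n = 1 \<and>
     sol_metric (X s t) n (deriv_s X s t) = 0 \<and> sol_metric (X s t) n (deriv_t X s t) = 0"

text \<open>
  The extrinsic curvature is the determinant of the second fundamental form relative to the first.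
  A regular surface has exactly two unit normals at each point, opposite to each other, and both
  yield the same value, so the choice made by \<open>SOME\<close> is immaterial.
\<close>

definition sol_extrinsic_curvature :: "(real \<Rightarrow> real \<Rightarrow> real^3) \<Rightarrow> real \<Rightarrow> real \<Rightarrow> real" where
  "sol_extrinsic_curvature X s t =
     (let g = sol_metric (X s t);
          Xs = deriv_s X s t;
          Xt = deriv_t X s t;
          n = (SOME n. sol_unit_normal X s t n);
          h_ss = g (sol_covariant_deriv (\<lambda>r. X r t) (\<lambda>r. deriv_s X r t) s) n;
          h_st = g (sol_covariant_deriv (\<lambda>r. X r t) (\<lambda>r. deriv_t X r t) s) n;
          h_tt = g (sol_covariant_deriv (X s) (deriv_t X s) t) n
      in (h_ss * h_tt - h_st\<^sup>2) / (g Xs Xs * g Xt Xt - (g Xs Xt)\<^sup>2))"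

definition sol_cos_angle :: "real^3 \<Rightarrow> real^3 \<Rightarrow> real^3 \<Rightarrow> real" where
  "sol_cos_angle p u v = sol_metric p u v / (sqrt (sol_metric p u u) * sqrt (sol_metric p v v))"

definition foliation2 :: "(real^3) set set" where
  "foliation2 = range (\<lambda>t. {vector [x, t, z] |x z. True})"

definition foliation3 :: "(real^3) set set" where
  "foliation3 = range (\<lambda>t. {vector [x, y, t] |x y. True})"

definition T1 :: "real \<Rightarrow> real^3 \<Rightarrow> real^3" where
  "T1 c p = vector [p$1 + c, p$2, p$3]"

definition generating_curve :: "(real \<Rightarrow> real) \<Rightarrow> (real \<Rightarrow> real) \<Rightarrow> real \<Rightarrow> real^3" where
  "generating_curve y z s = vector [0, y s, z s]"

definition invariant_param :: "(real \<Rightarrow> real) \<Rightarrow> (real \<Rightarrow> real) \<Rightarrow> real \<Rightarrow> real \<Rightarrow> real^3" where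
  "invariant_param y z s t = vector [t, y s, z s]"

definition invariant_surface :: "real set \<Rightarrow> (real \<Rightarrow> real) \<Rightarrow> (real \<Rightarrow> real) \<Rightarrow> (real^3) set" where
  "invariant_surface I y z = {invariant_param y z s t |s t. s \<in> I}"

lemma invariant_param_eq_T1: "invariant_param y z s t = T1 t (generating_curve y z s)"
  by (simp add: invariant_param_def T1_def generating_curve_def vector_3)

lemma T1_invariant_surface: "T1 c ` invariant_surface I y z = invariant_surface I y z"
proof
  have T: "T1 c (invariant_param y z s t) = invariant_param y z s (t + c)" for s t
    by (simp add: invariant_param_def T1_def vector_3)
  show "T1 c ` invariant_surface I y z \<subseteq> invariant_surface I y z"
    unfolding invariant_surface_def using T by blast
  show "invariant_surface I y z \<subseteq> T1 c ` invariant_surface I y z"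
  proof
    fix p assume "p \<in> invariant_surface I y z"
    then obtain s t where p: "p = invariant_param y z s t" and s: "s \<in> I"
      by (auto simp: invariant_surface_def)
    have "p = T1 c (invariant_param y z s (t - c))"
      by (simp add: T p)
    then show "p \<in> T1 c ` invariant_surface I y z"
      unfolding invariant_surface_def using s by blast
  qed
qed

definition smooth_on_reals :: "real set \<Rightarrow> (real \<Rightarrow> real) \<Rightarrow> bool" where
  "smooth_on_reals I f \<longleftrightarrow> (\<forall>n. \<forall>s\<in>I. ((deriv ^^ n) f) differentiable (at s))"

text \<open>
  A smooth arc length parametrization with angle function \<open>\<theta>\<close> on a nonempty open interval
  \<open>I\<close>, generating a surface of constant extrinsic curvature \<open>c\<close>.
\<close>

definition const_Kext_solution ::
  "real \<Rightarrow> real set \<Rightarrow> (real \<Rightarrow> real) \<Rightarrow> (real \<Rightarrow> real) \<Rightarrow> (real \<Rightarrow> real) \<Rightarrow> bool" where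
  "const_Kext_solution c I y z \<theta> \<longleftrightarrow>
     open I \<and> is_interval I \<and> I \<noteq> {} \<and>
     smooth_on_reals I y \<and> smooth_on_reals I z \<and> smooth_on_reals I \<theta> \<and>
     (\<forall>s\<in>I. (y has_real_derivative exp (z s) * cos (\<theta> s)) (at s)) \<and>
     (\<forall>s\<in>I. (z has_real_derivative sin (\<theta> s)) (at s)) \<and>
     (\<forall>s\<in>I. \<forall>t. sol_extrinsic_curvature (invariant_param y z) s t = c)"

definition maximal_const_Kext_solution ::
  "real \<Rightarrow> real set \<Rightarrow> (real \<Rightarrow> real) \<Rightarrow> (real \<Rightarrow> real) \<Rightarrow> (real \<Rightarrow> real) \<Rightarrow> bool" where
  "maximal_const_Kext_solution c I y z \<theta> \<longleftrightarrow>
     const_Kext_solution c I y z \<theta> \<and>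
     (\<forall>J y' z' \<theta>'. const_Kext_solution c J y' z' \<theta>' \<and> I \<subseteq> J \<and>
        (\<forall>s\<in>I. y' s = y s \<and> z' s = z s \<and> \<theta>' s = \<theta> s) \<longrightarrow> J = I)"

inductive_set sol_constants_group :: "(real^3 \<Rightarrow> real^3) set" where
  translation: "(\<lambda>p. vector [p$1, p$2 + b, p$3]) \<in> sol_constants_group"
| boost: "(\<lambda>p. vector [exp l * p$1, exp (- l) * p$2, p$3 - l]) \<in> sol_constants_group"
| reflection: "(\<lambda>p. vector [p$1, - (p$2), p$3]) \<in> sol_constants_group"
| composition: "\<lbrakk>\<Phi> \<in> sol_constants_group; \<Psi> \<in> sol_constants_group\<rbrakk>
    \<Longrightarrow> \<Phi> \<circ> \<Psi> \<in> sol_constants_group"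

definition eq_up_to_constants ::
  "(real \<Rightarrow> real^3) \<Rightarrow> real set \<Rightarrow> (real \<Rightarrow> real^3) \<Rightarrow> real set \<Rightarrow> bool" where
  "eq_up_to_constants \<alpha> I \<beta> J \<longleftrightarrow>
     (\<exists>\<Phi>\<in>sol_constants_group. \<exists>\<epsilon>\<in>{1, -1}. \<exists>s0.
        J = {s. \<epsilon> * s + s0 \<in> I} \<and> (\<forall>s\<in>J. \<beta> s = \<Phi> (\<alpha> (\<epsilon> * s + s0))))"

definition is_graph_of :: "(real \<Rightarrow> real^3) \<Rightarrow> real set \<Rightarrow> (real \<Rightarrow> real) \<Rightarrow> real set \<Rightarrow> bool" where
  "is_graph_of \<alpha> I f A \<longleftrightarrow> \<alpha> ` I = {vector [0, y, f y] |y. y \<in> A}"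

definition asymptotic_to_line :: "(real \<Rightarrow> real) \<Rightarrow> real set \<Rightarrow> real \<Rightarrow> bool" where
  "asymptotic_to_line f A y0 \<longleftrightarrow> filterlim (\<lambda>y. \<bar>f y\<bar>) at_top (at y0 within A)"

definition local_extremum :: "(real \<Rightarrow> real) \<Rightarrow> real \<Rightarrow> bool" where
  "local_extremum f p \<longleftrightarrow>
     (\<forall>\<^sub>F q in at p. f q \<le> f p) \<or> (\<forall>\<^sub>F q in at p. f p \<le> f q)"

text \<open>A strict global maximum or minimum on an open set which is the only local extremum there.\<close>

definition single_max_or_min :: "(real \<Rightarrow> real) \<Rightarrow> real set \<Rightarrow> bool" where
  "single_max_or_min f A \<longleftrightarrow>
     (\<exists>p\<in>A. ((\<forall>q\<in>A - {p}. f q < f p) \<or> (\<forall>q\<in>A - {p}. f p < f q)) \<and>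
             (\<forall>q\<in>A. local_extremum f q \<longrightarrow> q = p))"

text \<open>
  The tangent direction of the curve tends to the direction of the \<open>z\<close>-axis (the angle between
  them tends to 0 modulo \<open>\<pi>\<close>) as the \<open>y\<close>-coordinate of the point on the curve tends to \<open>y0\<close>.
\<close>

definition vertical_towards :: "(real \<Rightarrow> real^3) \<Rightarrow> real set \<Rightarrow> real \<Rightarrow> bool" where
  "vertical_towards \<alpha> I y0 \<longleftrightarrow>
     ((\<lambda>s. \<bar>sol_cos_angle (\<alpha> s) (vector_derivative \<alpha> (at s)) (axis 3 1)\<bar>) \<longlongrightarrow> 1)
       (inf (filtercomap (\<lambda>s. \<alpha> s $ 2) (nhds y0)) (principal I))"

end

theory Submission
  imports Defs
begin

text \<open>
The coordinate curves \<open>t \<mapsto> X(s, t)\<close> and \<open>s \<mapsto> X(s, t)\<close> diagonalise both fundamental forms,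
which gives \<open>K = - cos \<theta> * (\<theta>' + cos \<theta>)\<close> (\<open>extrinsic_curvature_invariant_param\<close>). The
classification rests on the substitution \<open>v = exp (- z)\<close>: then \<open>v' = - v sin \<theta>\<close>, and \<open>K = c\<close>
becomes the \<^emph>\<open>linear\<close> equation \<open>v'' = (1 + c) v\<close>.

If \<open>c \<noteq> 0\<close>, the curvature equation forces \<open>cos \<theta> \<noteq> 0\<close>. If \<open>c = 0\<close>, then \<open>(v cos \<theta>)\<^sup>2\<close> is conserved
(\<open>flat_first_integral\<close>), so \<open>cos \<theta>\<close> vanishes nowhere or identically; in the second case the surface
is a leaf of the second foliation (\<open>vertical_leaf\<close>).

Where \<open>cos \<theta> \<noteq> 0\<close>, the curve can be recovered from \<open>v\<close>: \<open>sin \<theta> = - v' / v\<close> and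
\<open>y' = \<plusminus> sqrt (v\<^sup>2 - v'\<^sup>2) / v\<^sup>2\<close>. Conversely a solution of the linear equation, which exists on the
whole line, defines a curve on every interval where \<open>\<bar>v'\<bar> < v\<close>. So a maximal curve lives exactly on
a connected component of \<open>{s. \<bar>v' s\<bar> < v s}\<close> (\<open>maximal_profile_exists\<close>), and the four cases are
four kinds of solutions of \<open>v'' = k v\<close> with \<open>k = 1 + c\<close>.

\<^item> For \<open>k = 1\<close>, \<open>v\<close> is a multiple of a shifted \<open>cosh\<close>, and for \<open>k = 0\<close> it is affine; both
  integrate explicitly (\<open>zero_curvature_case\<close>, \<open>curvature_minus_one_case\<close>).
\<^item> For \<open>0 < k < 1\<close>, \<open>v\<close> is a combination of \<open>exp (w s)\<close> and \<open>exp (- w s)\<close> with \<open>w = sqrt k < 1\<close>.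
  A single exponential gives a logarithm. Otherwise each infinite end of the domain is an end where
  \<open>v\<close> grows exponentially, so \<open>z = - ln v\<close> diverges while \<open>y' \<le> 1 / v\<close> is integrable: a vertical
  asymptote (\<open>curvature_in_between_case\<close>).
\<^item> For \<open>k > 1\<close> or \<open>k < 0\<close>, the slope \<open>u = sin \<theta>\<close> satisfies \<open>u' = u\<^sup>2 - k\<close>, whose right-hand side has
  a fixed sign and is bounded away from zero for \<open>\<bar>u\<bar> < 1\<close>. So \<open>u\<close> runs from one of \<open>\<plusminus> 1\<close> to the other
  in finite time (\<open>vertical_ends_case\<close>).
\<close>

section \<open>The extrinsic curvature of an invariant surface\<close>

lemma matrix_inv_diagonal:
  fixes d :: "'n::finite \<Rightarrow> real"
  assumes "\<And>i. d i \<noteq> 0"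
  shows "matrix_inv (\<chi> i j. if i = j then d i else 0) = (\<chi> i j. if i = j then inverse (d i) else 0)"
    (is "matrix_inv ?A = ?B")
proof -
  have delta: "(\<Sum>k\<in>UNIV. (if i = k then a else 0) * (if k = j then f k else 0)) =
      (if i = j then a * f i else 0)" for a :: real and f and i j :: "'n"
  proof -
    have "(\<Sum>k\<in>UNIV. (if i = k then a else 0) * (if k = j then f k else 0)) =
        (\<Sum>k\<in>UNIV. if k = i then (if i = j then a * f i else 0) else 0)"
      by (rule sum.cong) auto
    then show ?thesis by (simp only: sum.delta finite UNIV_I if_True)
  qed
  have AB: "?A ** ?B = mat 1" and BA: "?B ** ?A = mat 1"
    by (simp_all only: vec_eq_iff matrix_matrix_mult_def vec_lambda_beta delta mat_def)
       (simp_all add: assms)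
  have "\<exists>B. ?A ** B = mat 1 \<and> B ** ?A = mat 1" using AB BA by blast
  then have inv: "matrix_inv ?A ** ?A = mat 1"
    unfolding matrix_inv_def by (rule someI2_ex) (elim conjE)
  have "matrix_inv ?A = matrix_inv ?A ** (?A ** ?B)" unfolding AB by (simp only: matrix_mul_rid)
  also have "\<dots> = ?B" unfolding matrix_mul_assoc inv by (simp only: matrix_mul_lid)
  finally show ?thesis .
qed

definition sol_metric_diagonal :: "real^3 \<Rightarrow> 3 \<Rightarrow> real" where
  "sol_metric_diagonal p i = (if i = 1 then exp (2 * p$3) else if i = 2 then exp (- 2 * p$3) else 1)"

lemma sol_metric_matrix_diagonal:
  "sol_metric_matrix p = (\<chi> i j. if i = j then sol_metric_diagonal p i else 0)"
proof -
  have "sol_metric_matrix p $ i $ j = (if i = j then sol_metric_diagonal p i else 0)" for i j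
    using exhaust_3[of i] exhaust_3[of j]
    by (auto simp: sol_metric_matrix_def sol_metric_def axis_def sol_metric_diagonal_def)
  then show ?thesis by (simp add: vec_eq_iff)
qed

lemma sol_metric_diagonal_pos: "sol_metric_diagonal p i > 0"
  by (simp add: sol_metric_diagonal_def)

text \<open>
The metric depends on the third coordinate only, through \<open>exp (2 * z)\<close> and \<open>exp (- 2 * z)\<close>.
\<close>

lemma partial_deriv_sol_metric_matrix: "partial_deriv l (\<lambda>q. sol_metric_matrix q $ i $ j) p =
   (if l = 3 \<and> i = j then (if i = 1 then 2 else if i = 2 then - 2 else 0) * sol_metric_diagonal p i
    else 0)"
proof -
  define a :: real where "a = (if l = 3 then 1 else 0)"
  have line: "(p + h *\<^sub>R axis l 1)$3 = p$3 + h * a" for h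
    by (simp add: a_def axis_def)
  have "((\<lambda>h. sol_metric_diagonal (p + h *\<^sub>R axis l 1) i) has_real_derivative
      a * (if i = 1 then 2 else if i = 2 then - 2 else 0) * sol_metric_diagonal p i) (at 0)"
    unfolding sol_metric_diagonal_def line
    by (cases "i = 1"; cases "i = 2"; simp; (rule derivative_eq_intros refl | simp)+)
  from DERIV_imp_deriv[OF this]
  have *: "deriv (\<lambda>h. sol_metric_diagonal (p + h *\<^sub>R axis l 1) i) 0 =
      a * (if i = 1 then 2 else if i = 2 then - 2 else 0) * sol_metric_diagonal p i" .
  show ?thesis
  proof (cases "i = j")
    case True
    show ?thesis
      unfolding partial_deriv_def sol_metric_matrix_diagonal vec_lambda_beta
      by (simp only: True simp_thms if_True *[unfolded True]) (simp add: a_def)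
  qed (simp add: partial_deriv_def sol_metric_matrix_diagonal)
qed

text \<open>
The metric is diagonal, so the sum over \<open>l\<close> in the Christoffel formula reduces to the term
\<open>l = k\<close>.
\<close>

lemma sol_christoffel_eq: "sol_christoffel p k i j =
   (if k = 1 \<and> (i = 1 \<and> j = 3 \<or> i = 3 \<and> j = 1) then 1
    else if k = 2 \<and> (i = 2 \<and> j = 3 \<or> i = 3 \<and> j = 2) then - 1
    else if k = 3 \<and> i = 1 \<and> j = 1 then - exp (2 * p$3)
    else if k = 3 \<and> i = 2 \<and> j = 2 then exp (- 2 * p$3) else 0)"
proof -
  define d where "d = sol_metric_diagonal p"
  have d0: "d m \<noteq> 0" for m
    using sol_metric_diagonal_pos[of p m] by (simp add: d_def)
  have d: "d 1 = exp (2 * p$3)" "d 2 = exp (- 2 * p$3)" "d 3 = 1"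
    by (simp_all add: d_def sol_metric_diagonal_def)
  have "sol_christoffel p k i j = 1/2 * (\<Sum>l\<in>UNIV. if l = k then inverse (d k) *
      (partial_deriv i (\<lambda>q. sol_metric_matrix q $ j $ k) p
       + partial_deriv j (\<lambda>q. sol_metric_matrix q $ i $ k) p
       - partial_deriv k (\<lambda>q. sol_metric_matrix q $ i $ j) p) else 0)"
    unfolding sol_christoffel_def
    by (intro arg_cong2[where f = "(*)"] refl sum.cong)
       (auto simp: sol_metric_matrix_diagonal[of p] matrix_inv_diagonal d0[unfolded d_def] d_def)
  then have *: "sol_christoffel p k i j = 1/2 * (inverse (d k) *
      (partial_deriv i (\<lambda>q. sol_metric_matrix q $ j $ k) p
       + partial_deriv j (\<lambda>q. sol_metric_matrix q $ i $ k) p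
       - partial_deriv k (\<lambda>q. sol_metric_matrix q $ i $ j) p))"
    by (simp only: sum.delta finite UNIV_I if_True)
  show ?thesis
    unfolding * partial_deriv_sol_metric_matrix d(1,2)[symmetric] d_def[symmetric]
    using exhaust_3[of i] exhaust_3[of j] exhaust_3[of k] d0[of 1] d0[of 2] d(3)
    by (elim disjE; hypsubst; simp)
qed


lemma sol_metric_vector:
  "sol_metric (vector [a, b, h]) u v = exp (2 * h) * u$1 * v$1 + exp (- 2 * h) * u$2 * v$2 + u$3 * v$3"
  by (simp add: sol_metric_def)

lemma has_vector_derivative_vector_3:
  assumes "(f has_real_derivative f') (at s)" "(g has_real_derivative g') (at s)"
    "(h has_real_derivative h') (at s)"
  shows "((\<lambda>s. vector [f s, g s, h s] :: real^3) has_vector_derivative vector [f', g', h']) (at s)"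
proof -
  have eq: "(vector [p, q, r] :: real^3) = p *\<^sub>R axis 1 1 + q *\<^sub>R axis 2 1 + r *\<^sub>R axis 3 (1::real)"
    for p q r :: real
    by (simp add: vec_eq_iff forall_3 axis_def)
  show ?thesis
    unfolding eq by (rule derivative_eq_intros assms refl)+ (simp add: algebra_simps)
qed

lemma sol_covariant_deriv_eq:
  assumes "(\<gamma> has_vector_derivative vector [a1, a2, a3]) (at r)"
    and "(V has_vector_derivative vector [b1, b2, b3]) (at r)"
    and "\<gamma> r = vector [p1, p2, p3]" and "V r = vector [v1, v2, v3]"
  shows "sol_covariant_deriv \<gamma> V r = vector
    [b1 + a1 * v3 + a3 * v1, b2 - a2 * v3 - a3 * v2,
     b3 - exp (2 * p3) * a1 * v1 + exp (- 2 * p3) * a2 * v2]"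
  unfolding sol_covariant_deriv_def vector_derivative_at[OF assms(1)] vector_derivative_at[OF assms(2)]
    assms(3,4) sol_christoffel_eq vec_eq_iff forall_3 sum_3
  by simp

text \<open>
The unit normals are \<open>\<plusminus> (0, - e N, C)\<close> with \<open>e = exp z\<close>, \<open>C = cos \<theta>\<close>, \<open>N = sin \<theta>\<close>. The field
\<open>X\<^sub>t\<close> has a covariant derivative along \<open>s\<close> that is tangent to the surface, so the second
fundamental form is diagonal, with entries \<open>\<plusminus> (\<theta>' + C)\<close> and \<open>\<minusplus> e\<^sup>2 C\<close>; the first one is diagonal with
entries \<open>1\<close> and \<open>e\<^sup>2\<close>.
\<close>

lemma extrinsic_curvature_invariant_param:
  assumes I: "open I" "s \<in> I"
    and y: "\<And>s. s \<in> I \<Longrightarrow> (y has_real_derivative exp (z s) * cos (\<theta> s)) (at s)"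
    and z: "\<And>s. s \<in> I \<Longrightarrow> (z has_real_derivative sin (\<theta> s)) (at s)"
    and \<theta>: "(\<theta> has_real_derivative \<theta>') (at s)"
  shows "sol_extrinsic_curvature (invariant_param y z) s t = - cos (\<theta> s) * (\<theta>' + cos (\<theta> s))"
proof -
  define e where "e = exp (z s)"
  have e_double: "exp (2 * z s) = e\<^sup>2"
    by (simp add: e_def exp_double)
  then have e: "e > 0" "exp (2 * z s) = e\<^sup>2" "exp (- 2 * z s) = 1 / e\<^sup>2"
    by (simp_all add: e_def exp_minus inverse_eq_divide)
  define C where "C = cos (\<theta> s)"
  define N where "N = sin (\<theta> s)"
  have CN: "C\<^sup>2 + N\<^sup>2 = 1" by (simp add: C_def N_def)
  let ?X = "invariant_param y z"
  have Xs: "((\<lambda>r. ?X r t) has_vector_derivative vector [0, exp (z r) * cos (\<theta> r), sin (\<theta> r)]) (at r)"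
    if "r \<in> I" for r t
    unfolding invariant_param_def
    by (rule has_vector_derivative_vector_3) (auto intro!: y z that)
  have Xt: "(?X r has_vector_derivative vector [1, 0, 0]) (at t)" for r t
    unfolding invariant_param_def[abs_def]
    by (rule has_vector_derivative_vector_3) (auto intro!: derivative_eq_intros)
  have ds: "deriv_s ?X r t = vector [0, exp (z r) * cos (\<theta> r), sin (\<theta> r)]" if "r \<in> I" for r t
    unfolding deriv_s_def by (rule vector_derivative_at[OF Xs[OF that]])
  have dt: "deriv_t ?X r t = vector [1, 0, 0]" for r t
    unfolding deriv_t_def by (rule vector_derivative_at[OF Xt])
  have "((\<lambda>r. vector [0, exp (z r) * cos (\<theta> r), sin (\<theta> r)] :: real^3) has_vector_derivative
      vector [0, e * (N * C - N * \<theta>'), C * \<theta>']) (at s)"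
    by (rule has_vector_derivative_vector_3)
       (auto intro!: derivative_eq_intros z[OF I(2)] \<theta> simp: e_def C_def N_def algebra_simps)
  then have Xss: "((\<lambda>r. deriv_s ?X r t) has_vector_derivative vector [0, e * (N * C - N * \<theta>'), C * \<theta>']) (at s)"
    by (rule has_vector_derivative_transform_within_open[OF _ I]) (simp add: ds)
  have const: "((\<lambda>r. vector [1, 0, 0] :: real^3) has_vector_derivative vector [0, 0, 0]) (at r)" for r
    by (rule has_vector_derivative_vector_3) auto
  have Xs': "((\<lambda>r. ?X r t) has_vector_derivative vector [0, e * C, N]) (at s)"
    using Xs[OF I(2)] by (simp add: e_def C_def N_def)
  have X: "?X s t = vector [t, y s, z s]" by (simp add: invariant_param_def)
  have ds': "deriv_s ?X s t = vector [0, e * C, N]"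
    using ds[OF I(2)] by (simp add: e_def C_def N_def)
  define T where "T = \<theta>' + C"
  have Dss: "sol_covariant_deriv (\<lambda>r. ?X r t) (\<lambda>r. deriv_s ?X r t) s = vector [0, - e * N * T, C * T]"
    unfolding sol_covariant_deriv_eq[OF Xs' Xss X ds'] using e
    by (simp add: T_def vec_eq_iff forall_3 field_simps power2_eq_square)
  have Dst: "sol_covariant_deriv (\<lambda>r. ?X r t) (\<lambda>r. deriv_t ?X r t) s = vector [N, 0, 0]"
    unfolding dt sol_covariant_deriv_eq[OF Xs' const X refl]
    by (simp add: vec_eq_iff forall_3)
  have Dtt: "sol_covariant_deriv (?X s) (deriv_t ?X s) t = vector [0, 0, - (e\<^sup>2)]"
    unfolding dt[abs_def] sol_covariant_deriv_eq[OF Xt const X refl] e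
    by (simp add: vec_eq_iff forall_3)
  define n where "n = (SOME n. sol_unit_normal ?X s t n)"
  have metric: "sol_metric (?X s t) u v = e\<^sup>2 * u$1 * v$1 + u$2 * v$2 / e\<^sup>2 + u$3 * v$3" for u v
    unfolding X sol_metric_vector e by simp
  have "sol_unit_normal ?X s t (vector [0, - e * N, C])"
    unfolding sol_unit_normal_def metric ds' dt using e(1) CN
    by (simp add: power2_eq_square field_simps)
  then have "sol_unit_normal ?X s t n"
    unfolding n_def by (rule someI)
  then have n: "(n$2)\<^sup>2 / e\<^sup>2 + (n$3)\<^sup>2 = 1" "n$2 * C / e + n$3 * N = 0" "n$1 = 0"
    unfolding sol_unit_normal_def metric ds' dt using e(1)
    by (auto simp: power2_eq_square mult.assoc)
  \<comment> \<open>The normal in the orthonormal frame of the metric; only its sign is undetermined, and the product of the two diagonal entries does not see the sign.\<close>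
  define a where "a = n$2 / e"
  define b where "b = n$3"
  have ab: "a\<^sup>2 + b\<^sup>2 = 1" "a * C + b * N = 0"
    using n by (simp_all add: a_def b_def power_divide)
  have first: "sol_metric (?X s t) (deriv_s ?X s t) (deriv_s ?X s t) * sol_metric (?X s t) (deriv_t ?X s t) (deriv_t ?X s t)
      - (sol_metric (?X s t) (deriv_s ?X s t) (deriv_t ?X s t))\<^sup>2 = e\<^sup>2"
    unfolding metric ds' dt using e(1) CN by (simp add: power2_eq_square)
  have "sol_extrinsic_curvature ?X s t =
      ((- a * N * T + C * T * b) * (- (e\<^sup>2) * b) - 0\<^sup>2) / e\<^sup>2"
    unfolding sol_extrinsic_curvature_def Let_def n_def[symmetric] first
    unfolding Dss Dst Dtt metric
    using e(1) n(3) by (simp add: a_def b_def power2_eq_square)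
  also have "\<dots> = - T * (- a * (b * N) + C * b\<^sup>2)"
    using e(1) by (simp add: field_simps power2_eq_square)
  also have "b * N = - a * C" using ab(2) by simp
  also have "- T * (- a * (- a * C) + C * b\<^sup>2) = - T * C * (a\<^sup>2 + b\<^sup>2)"
    by (simp add: algebra_simps power2_eq_square)
  finally show ?thesis using ab(1) by (simp add: T_def C_def algebra_simps)
qed

section \<open>Smooth solutions of the curvature equation\<close>

lemma eq_on_open_interval:
  fixes f g :: "real \<Rightarrow> real"
  assumes "open I" "is_interval I" "s0 \<in> I" "f s0 = g s0" "s \<in> I"
    and "\<And>s. s \<in> I \<Longrightarrow> (f has_real_derivative d s) (at s)"
    and "\<And>s. s \<in> I \<Longrightarrow> (g has_real_derivative d s) (at s)"
  shows "f s = g s"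
proof -
  have "\<exists>c. \<forall>s\<in>I. f s - g s = c"
  proof (rule has_field_derivative_zero_constant)
    show "convex I" using assms(2) by (simp add: is_interval_convex)
    show "((\<lambda>s. f s - g s) has_real_derivative 0) (at s within I)" if "s \<in> I" for s
      using DERIV_diff[OF assms(6,7)[OF that]] by (simp add: has_field_derivative_at_within)
  qed
  then obtain c where c: "\<And>s. s \<in> I \<Longrightarrow> f s - g s = c" by blast
  from c[OF assms(3)] c[OF assms(5)] assms(4) show ?thesis by simp
qed

lemma nonvanishing_sign:
  fixes f :: "real \<Rightarrow> real"
  assumes "is_interval I" "continuous_on I f" "\<And>s. s \<in> I \<Longrightarrow> f s \<noteq> 0"
  obtains \<sigma> :: real where "\<sigma> \<in> {1, -1}" "\<And>s. s \<in> I \<Longrightarrow> \<sigma> * f s > 0"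
proof -
  have con: "connected (f ` I)"
    using assms(1,2) by (simp add: connected_continuous_image is_interval_connected)
  have "(\<forall>s\<in>I. f s > 0) \<or> (\<forall>s\<in>I. f s < 0)"
  proof (rule ccontr)
    assume "\<not> ?thesis"
    then obtain a b where "a \<in> I" "b \<in> I" "f a < 0" "f b > 0"
      using assms(3) by (metis linorder_neqE_linordered_idom)
    then have "0 \<in> f ` I"
      using connectedD_interval[OF con, of "f a" "f b" 0] by auto
    then show False using assms(3) by auto
  qed
  then show thesis using that[of 1] that[of "-1"] by auto
qed

text \<open>
Smoothness is obtained without computing higher derivatives: it is enough to exhibit a class of
functions that contains \<open>f\<close> and is closed under differentiation on \<open>I\<close>.
\<close>

lemma smooth_on_reals_closed_class:
  assumes "open I" "f \<in> P"
    and closed: "\<And>f. f \<in> P \<Longrightarrow> \<exists>g\<in>P. \<forall>s\<in>I. (f has_real_derivative g s) (at s)"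
  shows "smooth_on_reals I f"
proof -
  have ind: "\<exists>g\<in>P. \<forall>s\<in>I. (deriv ^^ n) f s = g s" for n
  proof (induction n)
    case 0
    show ?case using assms(2) by auto
  next
    case (Suc n)
    then obtain g where g: "g \<in> P" "\<And>s. s \<in> I \<Longrightarrow> (deriv ^^ n) f s = g s" by blast
    obtain h where h: "h \<in> P" "\<And>s. s \<in> I \<Longrightarrow> (g has_real_derivative h s) (at s)"
      using closed[OF g(1)] by blast
    have "(deriv ^^ Suc n) f s = h s" if "s \<in> I" for s
    proof -
      have "((deriv ^^ n) f has_real_derivative h s) (at s)"
        by (rule has_field_derivative_transform_within_open[OF h(2)[OF that] assms(1) that])
           (simp add: g(2))
      then show ?thesis by (simp add: DERIV_imp_deriv)
    qed
    with h(1) show ?case by blast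
  qed
  show ?thesis
    unfolding smooth_on_reals_def
  proof (intro allI ballI)
    fix n s assume s: "s \<in> I"
    obtain g where g: "g \<in> P" "\<And>s. s \<in> I \<Longrightarrow> (deriv ^^ n) f s = g s" using ind by blast
    obtain h where h: "\<And>s. s \<in> I \<Longrightarrow> (g has_real_derivative h s) (at s)"
      using closed[OF g(1)] by blast
    have "((deriv ^^ n) f has_real_derivative h s) (at s)"
      by (rule has_field_derivative_transform_within_open[OF h[OF s] assms(1) s]) (simp add: g(2))
    then show "(deriv ^^ n) f differentiable at s"
      using real_differentiable_def by blast
  qed
qed

text \<open>
The class used for the solutions: the right-hand sides of the differential equations for
\<open>y\<close>, \<open>z\<close>, \<open>\<theta>\<close> belong to it as soon as \<open>\<theta>'\<close> is a polynomial in \<open>cos \<theta>\<close> and \<open>1 / cos \<theta>\<close>.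
\<close>

inductive_set curve_functions :: "(real \<Rightarrow> real) \<Rightarrow> (real \<Rightarrow> real) \<Rightarrow> (real \<Rightarrow> real) set"
  for z \<theta> where
  const: "(\<lambda>s. a) \<in> curve_functions z \<theta>"
| cos: "(\<lambda>s. cos (\<theta> s)) \<in> curve_functions z \<theta>"
| sin: "(\<lambda>s. sin (\<theta> s)) \<in> curve_functions z \<theta>"
| sec: "(\<lambda>s. inverse (cos (\<theta> s))) \<in> curve_functions z \<theta>"
| exp: "(\<lambda>s. exp (z s)) \<in> curve_functions z \<theta>"
| add: "f \<in> curve_functions z \<theta> \<Longrightarrow> g \<in> curve_functions z \<theta> \<Longrightarrow> (\<lambda>s. f s + g s) \<in> curve_functions z \<theta>"
| mult: "f \<in> curve_functions z \<theta> \<Longrightarrow> g \<in> curve_functions z \<theta> \<Longrightarrow> (\<lambda>s. f s * g s) \<in> curve_functions z \<theta>"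

lemma curve_functions_deriv:
  assumes z: "\<And>s. s \<in> I \<Longrightarrow> (z has_real_derivative sin (\<theta> s)) (at s)"
    and \<theta>: "\<And>s. s \<in> I \<Longrightarrow> (\<theta> has_real_derivative T s) (at s)"
    and T: "T \<in> curve_functions z \<theta>"
    and cos_nz: "\<And>s. s \<in> I \<Longrightarrow> cos (\<theta> s) \<noteq> 0"
    and f: "f \<in> curve_functions z \<theta>"
  shows "\<exists>g\<in>curve_functions z \<theta>. \<forall>s\<in>I. (f has_real_derivative g s) (at s)"
  using f
proof induction
  case (const a)
  show ?case by (rule bexI[of _ "\<lambda>s. 0"]) (auto intro: curve_functions.const)
next
  case cos
  show ?case
    by (intro bexI[of _ "\<lambda>s. (- 1) * (sin (\<theta> s) * T s)"] ballI curve_functions.intros T)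
       (auto intro!: derivative_eq_intros \<theta>)
next
  case sin
  show ?case
    by (intro bexI[of _ "\<lambda>s. cos (\<theta> s) * T s"] ballI curve_functions.intros T)
       (auto intro!: derivative_eq_intros \<theta>)
next
  case sec
  show ?case
    by (intro bexI[of _ "\<lambda>s. inverse (cos (\<theta> s)) * inverse (cos (\<theta> s)) * (sin (\<theta> s) * T s)"] ballI curve_functions.intros T)
       (auto intro!: derivative_eq_intros \<theta> simp: cos_nz field_simps)
next
  case exp
  show ?case
    by (intro bexI[of _ "\<lambda>s. exp (z s) * sin (\<theta> s)"] ballI curve_functions.intros T)
       (auto intro!: derivative_eq_intros z)
next
  case (add f g)
  then obtain f' g' where *: "f' \<in> curve_functions z \<theta>" "g' \<in> curve_functions z \<theta>"
    "\<And>s. s \<in> I \<Longrightarrow> (f has_real_derivative f' s) (at s)"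
    "\<And>s. s \<in> I \<Longrightarrow> (g has_real_derivative g' s) (at s)" by blast
  show ?case
    by (rule bexI[of _ "\<lambda>s. f' s + g' s"]) (auto intro!: DERIV_add * curve_functions.add)
next
  case (mult f g)
  then obtain f' g' where *: "f' \<in> curve_functions z \<theta>" "g' \<in> curve_functions z \<theta>"
    "\<And>s. s \<in> I \<Longrightarrow> (f has_real_derivative f' s) (at s)"
    "\<And>s. s \<in> I \<Longrightarrow> (g has_real_derivative g' s) (at s)" by blast
  show ?case
    by (rule bexI[of _ "\<lambda>s. f' s * g s + g' s * f s"])
       (auto intro!: DERIV_mult * mult.hyps curve_functions.add curve_functions.mult)
qed

lemma const_Kext_solutionD:
  assumes "const_Kext_solution c I y z \<theta>"
  shows "open I" "is_interval I" "I \<noteq> {}"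
    and "\<And>s. s \<in> I \<Longrightarrow> (y has_real_derivative exp (z s) * cos (\<theta> s)) (at s)"
    and "\<And>s. s \<in> I \<Longrightarrow> (z has_real_derivative sin (\<theta> s)) (at s)"
    and "\<And>s. s \<in> I \<Longrightarrow> (\<theta> has_real_derivative deriv \<theta> s) (at s)"
    and "\<And>s. s \<in> I \<Longrightarrow> - cos (\<theta> s) * (deriv \<theta> s + cos (\<theta> s)) = c"
proof -
  note d = assms[unfolded const_Kext_solution_def]
  show I: "open I" "is_interval I" "I \<noteq> {}" using d by blast+
  show y: "(y has_real_derivative exp (z s) * cos (\<theta> s)) (at s)" if "s \<in> I" for s
    using d that by blast
  show z: "(z has_real_derivative sin (\<theta> s)) (at s)" if "s \<in> I" for s
    using d that by blast
  show \<theta>: "(\<theta> has_real_derivative deriv \<theta> s) (at s)" if "s \<in> I" for s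
  proof -
    have "((deriv ^^ 0) \<theta>) differentiable (at s)"
      using d that unfolding smooth_on_reals_def by blast
    then show ?thesis by (simp add: DERIV_deriv_iff_real_differentiable)
  qed
  show "- cos (\<theta> s) * (deriv \<theta> s + cos (\<theta> s)) = c" if s: "s \<in> I" for s
  proof -
    have "sol_extrinsic_curvature (invariant_param y z) s 0 = c" using d s by blast
    with extrinsic_curvature_invariant_param[of I s y z \<theta> "deriv \<theta> s" 0] I(1) s y z \<theta>
    show ?thesis by metis
  qed
qed

text \<open>
Where \<open>cos \<theta> \<noteq> 0\<close> the curvature condition can be solved for \<open>\<theta>'\<close>, and smoothness comes for free.
This is what allows extensions of a solution to be built by hand.
\<close>

lemma const_Kext_solutionI:
  assumes "open J" "is_interval J" "J \<noteq> {}"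
    and y: "\<And>s. s \<in> J \<Longrightarrow> (y has_real_derivative exp (z s) * cos (\<theta> s)) (at s)"
    and z: "\<And>s. s \<in> J \<Longrightarrow> (z has_real_derivative sin (\<theta> s)) (at s)"
    and \<theta>: "\<And>s. s \<in> J \<Longrightarrow> (\<theta> has_real_derivative - c / cos (\<theta> s) - cos (\<theta> s)) (at s)"
    and nz: "\<And>s. s \<in> J \<Longrightarrow> cos (\<theta> s) \<noteq> 0"
  shows "const_Kext_solution c J y z \<theta>"
proof -
  define T where "T s = (- c) * inverse (cos (\<theta> s)) + (- 1) * cos (\<theta> s)" for s
  have T: "T \<in> curve_functions z \<theta>"
    unfolding T_def[abs_def]
    by (intro curve_functions.add curve_functions.mult curve_functions.const
        curve_functions.sec curve_functions.cos)
  have \<theta>T: "(\<theta> has_real_derivative T s) (at s)" if "s \<in> J" for s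
    using \<theta>[OF that] by (simp add: T_def divide_inverse)
  note closed = curve_functions_deriv[where I = J and T = T and z = z and \<theta> = \<theta>]
  \<comment> \<open>The functions \<open>y\<close>, \<open>z\<close>, \<open>\<theta>\<close> themselves need not lie in the class, but their derivatives do.\<close>
  define P where "P = {f. \<exists>g\<in>curve_functions z \<theta>. \<forall>s\<in>J. (f has_real_derivative g s) (at s)}"
  have smooth: "smooth_on_reals J f" if "f \<in> P" for f
  proof (rule smooth_on_reals_closed_class[OF assms(1) that])
    fix f assume "f \<in> P"
    then show "\<exists>g\<in>P. \<forall>s\<in>J. (f has_real_derivative g s) (at s)"
    proof -
      obtain g where g: "g \<in> curve_functions z \<theta>" "\<forall>s\<in>J. (f has_real_derivative g s) (at s)"
        using \<open>f \<in> P\<close> unfolding P_def by (elim CollectE bexE)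
      have "g \<in> P" unfolding P_def by (rule CollectI, rule closed) (use z \<theta>T T nz g(1) in auto)
      with g(2) show ?thesis by (rule bexI)
    qed
  qed
  have "\<theta> \<in> P" using \<theta>T T by (auto simp: P_def)
  moreover have "z \<in> P" using z curve_functions.sin by (force simp: P_def)
  moreover have "y \<in> P"
    unfolding P_def using y curve_functions.mult[OF curve_functions.exp curve_functions.cos]
    by (intro CollectI bexI[of _ "\<lambda>s. exp (z s) * cos (\<theta> s)"]) auto
  moreover have "sol_extrinsic_curvature (invariant_param y z) s t = c" if "s \<in> J" for s t
    using extrinsic_curvature_invariant_param[OF assms(1) that y z \<theta>[OF that]] nz[OF that]
    by simp
  ultimately show ?thesis
    unfolding const_Kext_solution_def using assms smooth by auto
qed

section \<open>The linear equation \<open>v'' = k v\<close>\<close>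

lemma fundamental_solutions:
  fixes k :: real
  shows "\<exists>C S :: real \<Rightarrow> real. (\<forall>s. (C has_real_derivative k * S s) (at s)) \<and>
    (\<forall>s. (S has_real_derivative C s) (at s)) \<and> C 0 = 1 \<and> S 0 = 0"
proof -
  consider "k = 0" | w where "w > 0" "k = w\<^sup>2" | w where "w > 0" "k = - (w\<^sup>2)"
    by (metis neg_0_less_iff_less neg_equal_iff_equal linorder_neqE_linordered_idom
        minus_minus real_sqrt_gt_0_iff real_sqrt_pow2 less_imp_le)
  then show ?thesis
  proof cases
    case 1
    show ?thesis by (rule exI[of _ "\<lambda>s. 1"], rule exI[of _ "\<lambda>s. s"]) (auto simp: 1)
  next
    case 2
    show ?thesis
      by (rule exI[of _ "\<lambda>s. cosh (w * s)"], rule exI[of _ "\<lambda>s. sinh (w * s) / w"])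
         (use 2 in \<open>auto intro!: derivative_eq_intros simp: power2_eq_square\<close>)
  next
    case 3
    show ?thesis
      by (rule exI[of _ "\<lambda>s. cos (w * s)"], rule exI[of _ "\<lambda>s. sin (w * s) / w"])
         (use 3 in \<open>auto intro!: derivative_eq_intros simp: power2_eq_square\<close>)
  qed
qed

lemma linear_ode_exists:
  fixes k s0 a b :: real
  shows "\<exists>v v' :: real \<Rightarrow> real. (\<forall>s. (v has_real_derivative v' s) (at s)) \<and>
    (\<forall>s. (v' has_real_derivative k * v s) (at s)) \<and> v s0 = a \<and> v' s0 = b"
proof -
  obtain C S where CS: "\<And>s. (C has_real_derivative k * S s) (at s)"
    "\<And>s. (S has_real_derivative C s) (at s)" "C 0 = 1" "S 0 = 0"
    using fundamental_solutions[of k] by blast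
  have C: "((\<lambda>s. C (s - s0)) has_real_derivative k * S (s - s0)) (at s)" for s
    using DERIV_shift[of C _ s "- s0"] CS(1)[of "s - s0"] by simp
  have S: "((\<lambda>s. S (s - s0)) has_real_derivative C (s - s0)) (at s)" for s
    using DERIV_shift[of S _ s "- s0"] CS(2)[of "s - s0"] by simp
  show ?thesis
    by (rule exI[of _ "\<lambda>s. a * C (s - s0) + b * S (s - s0)"],
        rule exI[of _ "\<lambda>s. a * (k * S (s - s0)) + b * C (s - s0)"])
       (auto intro!: derivative_eq_intros C S simp: CS algebra_simps)
qed

text \<open>
The difference of two solutions is expanded in the fundamental solutions \<open>C\<close> and \<open>S\<close>; its
coefficients are constant and vanish at \<open>s0\<close>. The solution is recovered from the coefficients
because \<open>C\<^sup>2 - k S\<^sup>2 = 1\<close>.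
\<close>

lemma linear_ode_unique:
  fixes k :: real
  assumes I: "open I" "is_interval I" "s0 \<in> I" "s \<in> I"
    and f: "\<And>s. s \<in> I \<Longrightarrow> (f has_real_derivative f' s) (at s)"
      "\<And>s. s \<in> I \<Longrightarrow> (f' has_real_derivative k * f s) (at s)"
    and g: "\<And>s. s \<in> I \<Longrightarrow> (g has_real_derivative g' s) (at s)"
      "\<And>s. s \<in> I \<Longrightarrow> (g' has_real_derivative k * g s) (at s)"
    and init: "f s0 = g s0" "f' s0 = g' s0"
  shows "f s = g s"
proof -
  obtain C S where CS: "\<And>s. (C has_real_derivative k * S s) (at s)"
    "\<And>s. (S has_real_derivative C s) (at s)" "C 0 = 1" "S 0 = 0"
    using fundamental_solutions[of k] by blast
  have 1: "(C s)\<^sup>2 - k * (S s)\<^sup>2 = 1"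
    by (rule eq_on_open_interval[of UNIV 0 _ "\<lambda>_. 1" s "\<lambda>_. 0"])
       (auto intro!: derivative_eq_intros CS(1,2) simp: CS(3,4))
  define p where "p s = f s - g s" for s
  define q where "q s = f' s - g' s" for s
  have p: "(p has_real_derivative q s) (at s)" if "s \<in> I" for s
    unfolding p_def[abs_def] q_def by (intro DERIV_diff f(1) g(1) that)
  have q: "(q has_real_derivative k * p s) (at s)" if "s \<in> I" for s
    unfolding p_def q_def[abs_def] right_diff_distrib by (intro DERIV_diff f(2) g(2) that)
  have p0: "p s0 = 0" "q s0 = 0" using init by (simp_all add: p_def q_def)
  have 2: "p s * C s - q s * S s = 0"
    by (rule eq_on_open_interval[OF I(1-3) _ I(4), where g = "\<lambda>_. 0" and d = "\<lambda>_. 0"])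
       (auto intro!: derivative_eq_intros CS(1,2) p q simp: p0)
  have 3: "q s * C s - k * p s * S s = 0"
    by (rule eq_on_open_interval[OF I(1-3) _ I(4), where g = "\<lambda>_. 0" and d = "\<lambda>_. 0"])
       (auto intro!: derivative_eq_intros CS(1,2) p q simp: p0)
  have "p s = p s * ((C s)\<^sup>2 - k * (S s)\<^sup>2)" using 1 by simp
  also have "\<dots> = C s * (p s * C s - q s * S s) + S s * (q s * C s - k * p s * S s)"
    by (simp add: algebra_simps power2_eq_square)
  also have "\<dots> = 0" using 2 3 by simp
  finally show ?thesis by (simp add: p_def)
qed

section \<open>The profile of a maximal curve\<close>

lemma open_interval_antiderivative:
  fixes f :: "real \<Rightarrow> real"
  assumes "open J" "is_interval J" "continuous_on J f"
  obtains F where "\<And>s. s \<in> J \<Longrightarrow> (F has_real_derivative f s) (at s)"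
proof (cases "J = {}")
  case True
  then show ?thesis using that by auto
next
  case False
  \<comment> \<open>An open interval may be unbounded, so its end points are taken in the extended reals.\<close>
  define a where "a = (INF s\<in>J. ereal s)"
  define b where "b = (SUP s\<in>J. ereal s)"
  have up: "\<exists>t\<in>J. s < t" and lo: "\<exists>t\<in>J. t < s" if s: "s \<in> J" for s
  proof -
    obtain e where e: "e > 0" "ball s e \<subseteq> J" using assms(1) s open_contains_ball by blast
    then have "s + e/2 \<in> J" "s - e/2 \<in> J"
      by (auto intro!: subsetD[OF e(2)] simp: dist_real_def)
    then show "\<exists>t\<in>J. s < t" "\<exists>t\<in>J. t < s"
      using e(1) by (auto intro: bexI[of _ "s + e/2"] bexI[of _ "s - e/2"])
  qed
  have mem: "s \<in> J \<longleftrightarrow> a < ereal s \<and> ereal s < b" for s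
  proof
    assume "s \<in> J"
    with up[OF this] lo[OF this] show "a < ereal s \<and> ereal s < b"
      unfolding a_def b_def INF_less_iff less_SUP_iff by (auto simp: )
  next
    assume "a < ereal s \<and> ereal s < b"
    then obtain p q where "p \<in> J" "q \<in> J" "p < s" "s < q"
      unfolding a_def b_def INF_less_iff less_SUP_iff by auto
    then show "s \<in> J"
      using assms(2)[unfolded is_interval_1] by (meson less_imp_le)
  qed
  have "a < b" using False mem by (metis all_not_in_conv less_trans)
  moreover have "isCont f s" if "a < ereal s" "ereal s < b" for s
    using that assms(1,3) mem continuous_on_eq_continuous_at by blast
  ultimately obtain F where "\<And>s. a < ereal s \<Longrightarrow> ereal s < b \<Longrightarrow> (F has_vector_derivative f s) (at s)"
    using einterval_antiderivative[of a b f] by blast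
  then show ?thesis
    by (intro that[of F]) (simp add: mem has_real_derivative_iff_has_vector_derivative)
qed

text \<open>
What is left of a maximal solution with \<open>cos \<theta> \<noteq> 0\<close> after the substitution \<open>v = exp (- z)\<close>: a global
solution of \<open>v'' = k v\<close>, the choice of sign \<open>\<eta>\<close> of \<open>cos \<theta>\<close>, and a domain \<open>I\<close> that is maximal among the
open intervals on which \<open>\<bar>v'\<bar> < v\<close>. The inequality says that \<open>v > 0\<close> and that
\<open>sin \<theta> = - v' / v\<close> lies strictly between \<open>-1\<close> and \<open>1\<close>.
\<close>

locale maximal_profile =
  fixes k :: real and I :: "real set" and y z v v' :: "real \<Rightarrow> real" and \<eta> :: real
  assumes I: "open I" "is_interval I" "I \<noteq> {}"
    and v: "(v has_real_derivative v' s) (at s)" "(v' has_real_derivative k * v s) (at s)"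
    and cone: "s \<in> I \<Longrightarrow> \<bar>v' s\<bar> < v s"
    and z: "s \<in> I \<Longrightarrow> z s = - ln (v s)"
    and y: "s \<in> I \<Longrightarrow> (y has_real_derivative \<eta> * sqrt ((v s)\<^sup>2 - (v' s)\<^sup>2) / (v s)\<^sup>2) (at s)"
    and \<eta>: "\<eta> \<in> {1, -1}"
    and maximal: "open J \<Longrightarrow> is_interval J \<Longrightarrow> I \<subseteq> J \<Longrightarrow> \<forall>s\<in>J. \<bar>v' s\<bar> < v s \<Longrightarrow> J = I"

lemma sqrt_one_minus_ratio:
  fixes p q :: real
  assumes "p > 0"
  shows "sqrt (1 - (q / p)\<^sup>2) / p = sqrt (p\<^sup>2 - q\<^sup>2) / p\<^sup>2"
proof -
  have "1 - (q / p)\<^sup>2 = (p\<^sup>2 - q\<^sup>2) / p\<^sup>2"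
    using assms by (simp add: field_simps power_divide)
  then show ?thesis
    using assms by (simp add: real_sqrt_divide power2_eq_square)
qed

text \<open>
On an interval where \<open>\<bar>v'\<bar> < v\<close> the curve is rebuilt from \<open>v\<close>: \<open>z = - ln v\<close>, the angle is a branch of
\<open>arcsin (- v' / v)\<close> or of \<open>\<pi> - arcsin (- v' / v)\<close>, and \<open>y\<close> is an antiderivative of \<open>exp z * cos \<theta>\<close>.
The Riccati equation \<open>u' = u\<^sup>2 - (1 + c)\<close> for \<open>u = - v' / v\<close> is the curvature condition.
\<close>

lemma extend_solution:
  assumes sol: "const_Kext_solution c I y z \<theta>"
    and v: "\<And>s. (v has_real_derivative v' s) (at s)"
      "\<And>s. (v' has_real_derivative (1 + c) * v s) (at s)"
    and vI: "\<And>s. s \<in> I \<Longrightarrow> v s = exp (- z s)" "\<And>s. s \<in> I \<Longrightarrow> v' s = - sin (\<theta> s) * v s"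
    and \<sigma>: "\<sigma> \<in> {1, -1}" "\<And>s. s \<in> I \<Longrightarrow> \<sigma> * cos (\<theta> s) > 0"
    and J: "open J" "is_interval J" "I \<subseteq> J" "\<And>s. s \<in> J \<Longrightarrow> \<bar>v' s\<bar> < v s"
  obtains y' z' \<theta>' where "const_Kext_solution c J y' z' \<theta>'"
    "\<And>s. s \<in> I \<Longrightarrow> y' s = y s \<and> z' s = z s \<and> \<theta>' s = \<theta> s"
proof -
  note sol = const_Kext_solutionD[OF sol]
  obtain s0 where s0: "s0 \<in> I" using sol(3) by blast
  define u where "u s = - v' s / v s" for s
  have vpos: "v s > 0" if "s \<in> J" for s
    using J(4)[OF that] by linarith
  have u1: "\<bar>u s\<bar> < 1" if "s \<in> J" for s
    using J(4)[OF that] vpos[OF that] by (simp add: u_def abs_divide)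
  then have u: "- 1 < u s" "u s < 1" if "s \<in> J" for s
    using that by (auto simp: abs_less_iff)
  have cospos: "1 - (u s)\<^sup>2 > 0" if "s \<in> J" for s
    using u1[OF that] by (simp add: abs_square_less_1)
  have u_deriv: "(u has_real_derivative (u s)\<^sup>2 - (1 + c)) (at s)" if "s \<in> J" for s
    unfolding u_def[abs_def]
    by (rule derivative_eq_intros v refl)+ (use vpos[OF that] in \<open>simp_all add: field_simps power2_eq_square\<close>)
  have uI: "u s = sin (\<theta> s)" if "s \<in> I" for s
    using vI(2)[OF that] vpos[of s] J(3) that by (auto simp: u_def)
  have cosI: "cos (\<theta> s) = \<sigma> * sqrt (1 - (u s)\<^sup>2)" if "s \<in> I" for s
  proof -
    have "1 - (u s)\<^sup>2 = (\<sigma> * cos (\<theta> s))\<^sup>2"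
      using \<sigma>(1) by (auto simp: uI[OF that] cos_squared_eq)
    then have "sqrt (1 - (u s)\<^sup>2) = \<sigma> * cos (\<theta> s)"
      using \<sigma>(2)[OF that] by simp
    then show ?thesis using \<sigma>(1) by auto
  qed
  define \<theta>' where "\<theta>' s = \<theta> s0 - \<sigma> * arcsin (u s0) + \<sigma> * arcsin (u s)" for s
  \<comment> \<open>The phase \<open>\<phi>\<close> is a multiple of \<open>\<pi>\<close>, an even one exactly if \<open>\<sigma> = 1\<close>; all that matters is its sine and cosine.\<close>
  define \<phi> where "\<phi> = \<theta> s0 - \<sigma> * arcsin (u s0)"
  have s0J: "s0 \<in> J" using s0 J(3) by blast
  have sigarc: "sin (\<sigma> * arcsin (u s)) = \<sigma> * u s" "cos (\<sigma> * arcsin (u s)) = sqrt (1 - (u s)\<^sup>2)"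
    if "s \<in> J" for s
    using \<sigma>(1) u[OF that] by (auto simp: cos_arcsin)
  have \<phi>: "sin \<phi> = 0" "cos \<phi> = \<sigma>"
  proof -
    show "sin \<phi> = 0"
      unfolding \<phi>_def sin_diff sigarc[OF s0J] cosI[OF s0] uI[OF s0, symmetric]
      using \<sigma>(1) by auto
    have "cos \<phi> = \<sigma> * (sqrt (1 - (u s0)\<^sup>2))\<^sup>2 + \<sigma> * (u s0)\<^sup>2"
      unfolding \<phi>_def cos_diff sigarc[OF s0J] cosI[OF s0] uI[OF s0, symmetric]
      by (simp add: power2_eq_square)
    also have "\<dots> = \<sigma>" using cospos[OF s0J] by (simp add: algebra_simps)
    finally show "cos \<phi> = \<sigma>" .
  qed
  have \<theta>'_\<phi>: "\<theta>' s = \<phi> + \<sigma> * arcsin (u s)" for s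
    by (simp add: \<theta>'_def \<phi>_def)
  have \<theta>'_sin: "sin (\<theta>' s) = u s" and \<theta>'_cos: "cos (\<theta>' s) = \<sigma> * sqrt (1 - (u s)\<^sup>2)" if "s \<in> J" for s
    unfolding \<theta>'_\<phi> sin_add cos_add sigarc[OF that] \<phi> using \<sigma>(1) by auto
  have cos_nz: "cos (\<theta>' s) \<noteq> 0" if "s \<in> J" for s
    unfolding \<theta>'_cos[OF that] using \<sigma>(1) cospos[OF that] by auto
  have \<theta>'_deriv: "(\<theta>' has_real_derivative - c / cos (\<theta>' s) - cos (\<theta>' s)) (at s)" if "s \<in> J" for s
  proof -
    define q where "q = sqrt (1 - (u s)\<^sup>2)"
    have q: "q > 0" "q\<^sup>2 = 1 - (u s)\<^sup>2" using cospos[OF that] by (auto simp: q_def)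
    have "((\<lambda>s. arcsin (u s)) has_real_derivative inverse q * ((u s)\<^sup>2 - (1 + c))) (at s)"
      unfolding q_def by (rule DERIV_chain'[OF u_deriv[OF that] DERIV_arcsin, THEN DERIV_cong])
        (use u[OF that] in simp_all)
    then have "(\<theta>' has_real_derivative 0 + \<sigma> * (inverse q * ((u s)\<^sup>2 - (1 + c)))) (at s)"
      unfolding \<theta>'_def[abs_def] by (intro DERIV_add DERIV_const DERIV_cmult)
    moreover have "0 + \<sigma> * (inverse q * ((u s)\<^sup>2 - (1 + c))) = - c / (\<sigma> * q) - \<sigma> * q"
    proof -
      have us: "(u s)\<^sup>2 = 1 - q\<^sup>2" using q by simp
      show ?thesis using q(1) \<sigma>(1) unfolding us by (auto simp: field_simps power2_eq_square)
    qed
    ultimately show ?thesis unfolding \<theta>'_cos[OF that] q_def by simp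
  qed
  define z' where "z' s = - ln (v s)" for s
  have z'_deriv: "(z' has_real_derivative sin (\<theta>' s)) (at s)" if "s \<in> J" for s
    unfolding z'_def[abs_def] \<theta>'_sin[OF that] u_def
    by (rule derivative_eq_intros v refl | use vpos[OF that] in simp)+
  have "continuous_on J (\<lambda>s. exp (z' s) * cos (\<theta>' s))"
  proof (intro continuous_intros)
    show "continuous_on J z'"
      by (rule continuous_at_imp_continuous_on) (blast intro: DERIV_isCont z'_deriv)
    show "continuous_on J \<theta>'"
      by (rule continuous_at_imp_continuous_on) (blast intro: DERIV_isCont \<theta>'_deriv)
  qed
  then obtain F where F: "\<And>s. s \<in> J \<Longrightarrow> (F has_real_derivative exp (z' s) * cos (\<theta>' s)) (at s)"
    using open_interval_antiderivative[OF J(1,2)] by blast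
  define y' where "y' s = F s - F s0 + y s0" for s
  have y'_deriv: "(y' has_real_derivative exp (z' s) * cos (\<theta>' s)) (at s)" if "s \<in> J" for s
    unfolding y'_def[abs_def] using F[OF that] by (auto intro!: derivative_eq_intros)
  have "const_Kext_solution c J y' z' \<theta>'"
    by (rule const_Kext_solutionI[OF J(1,2)]) (use s0J y'_deriv z'_deriv \<theta>'_deriv cos_nz in auto)
  moreover have agree: "y' s = y s \<and> z' s = z s \<and> \<theta>' s = \<theta> s" if s: "s \<in> I" for s
  proof -
    have zz: "z' s = z s" if "s \<in> I" for s using vI(1)[OF that] by (simp add: z'_def)
    have \<theta>d: "(\<theta> has_real_derivative - c / cos (\<theta>' s) - cos (\<theta>' s)) (at s)" if "s \<in> I" for s
    proof -
      have "cos (\<theta>' s) = cos (\<theta> s)" using \<theta>'_cos cosI that J(3) by auto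
      moreover have "- cos (\<theta> s) * (deriv \<theta> s + cos (\<theta> s)) = c" by (rule sol(7)[OF that])
      moreover have "cos (\<theta> s) \<noteq> 0" using \<sigma>(2)[OF that] by auto
      ultimately have "deriv \<theta> s = - c / cos (\<theta>' s) - cos (\<theta>' s)" by (auto simp: field_simps)
      then show ?thesis using sol(6)[OF that] by simp
    qed
    have \<theta>\<theta>: "\<theta>' s = \<theta> s" if "s \<in> I" for s
    proof (rule eq_on_open_interval[OF sol(1,2) s0 _ that _ \<theta>d])
      show "\<theta>' s0 = \<theta> s0" by (simp add: \<theta>'_def)
    qed (use \<theta>'_deriv J(3) in blast)
    have "y' s = y s"
    proof (rule eq_on_open_interval[OF sol(1,2) s0 _ s _ sol(4)])
      show "(y' has_real_derivative exp (z t) * cos (\<theta> t)) (at t)" if "t \<in> I" for t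
        using y'_deriv[of t] zz[OF that] \<theta>\<theta>[OF that] J(3) that by auto
    qed (auto simp: y'_def)
    with zz \<theta>\<theta> s show ?thesis by blast
  qed
  ultimately show thesis using that by blast
qed

text \<open>
On \<open>I\<close> the function \<open>exp (- z)\<close> solves the linear equation \<open>v'' = (1 + c) v\<close>. It is continued to the
whole line as a solution of that equation, and \<open>extend_solution\<close> turns the maximality of the curve
into the maximality of \<open>I\<close> for the inequality \<open>\<bar>v'\<bar> < v\<close>.
\<close>

lemma maximal_profile_exists:
  assumes max: "maximal_const_Kext_solution c I y z \<theta>"
    and nz: "\<And>s. s \<in> I \<Longrightarrow> cos (\<theta> s) \<noteq> 0"
  obtains v v' \<eta> where "maximal_profile (1 + c) I y z v v' \<eta>"
proof -
  have cs: "const_Kext_solution c I y z \<theta>"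
    using max by (simp add: maximal_const_Kext_solution_def)
  note sol = const_Kext_solutionD[OF cs]
  obtain s0 where s0: "s0 \<in> I" using sol(3) by blast
  have "continuous_on I (\<lambda>s. cos (\<theta> s))"
    by (intro continuous_intros continuous_at_imp_continuous_on) (blast intro: DERIV_isCont sol(6))
  then obtain \<sigma> where \<sigma>: "\<sigma> \<in> {1, -1}" "\<And>s. s \<in> I \<Longrightarrow> \<sigma> * cos (\<theta> s) > 0"
    by (rule nonvanishing_sign[OF sol(2) _ nz]) auto
  obtain v v' where v: "\<And>s. (v has_real_derivative v' s) (at s)"
    "\<And>s. (v' has_real_derivative (1 + c) * v s) (at s)"
    and init: "v s0 = exp (- z s0)" "v' s0 = - sin (\<theta> s0) * exp (- z s0)"
    using linear_ode_exists[of "1 + c" s0 "exp (- z s0)" "- sin (\<theta> s0) * exp (- z s0)"] by blast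
  have f: "((\<lambda>s. exp (- z s)) has_real_derivative - sin (\<theta> s) * exp (- z s)) (at s)"
    if "s \<in> I" for s
    using sol(5)[OF that] by (auto intro!: derivative_eq_intros)
  have f': "((\<lambda>s. - sin (\<theta> s) * exp (- z s)) has_real_derivative (1 + c) * exp (- z s)) (at s)"
    if "s \<in> I" for s
  proof -
    have "((\<lambda>s. - sin (\<theta> s) * exp (- z s)) has_real_derivative
        - (cos (\<theta> s) * deriv \<theta> s) * exp (- z s) + - sin (\<theta> s) * (exp (- z s) * - sin (\<theta> s))) (at s)"
      using sol(5,6)[OF that] by (auto intro!: derivative_eq_intros)
    moreover have "- (cos (\<theta> s) * deriv \<theta> s) = c + (cos (\<theta> s))\<^sup>2"
      using sol(7)[OF that] by (simp add: algebra_simps power2_eq_square)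
    moreover have "(c + (cos (\<theta> s))\<^sup>2) * exp (- z s) + - sin (\<theta> s) * (exp (- z s) * - sin (\<theta> s))
        = (1 + c) * exp (- z s)"
    proof -
      have "(c + (cos (\<theta> s))\<^sup>2) * exp (- z s) + - sin (\<theta> s) * (exp (- z s) * - sin (\<theta> s))
        = (c + ((cos (\<theta> s))\<^sup>2 + (sin (\<theta> s))\<^sup>2)) * exp (- z s)"
        by (simp only: algebra_simps power2_eq_square)
      then show ?thesis by simp
    qed
    ultimately show ?thesis by simp
  qed
  have vI: "v s = exp (- z s)" if "s \<in> I" for s
    by (rule linear_ode_unique[OF sol(1,2) s0 that v(1,2) f f']) (use init in auto)
  have v'I: "v' s = - sin (\<theta> s) * v s" if "s \<in> I" for s
  proof -
    have "(v has_real_derivative - sin (\<theta> s) * exp (- z s)) (at s)"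
      by (rule has_field_derivative_transform_within_open[OF f[OF that] sol(1) that]) (simp add: vI)
    then show ?thesis using DERIV_unique[OF v(1)] vI[OF that] by simp
  qed
  have vpos: "v s > 0" if "s \<in> I" for s using vI[OF that] by simp
  have cone: "\<bar>v' s\<bar> < v s" if "s \<in> I" for s
  proof -
    have "(sin (\<theta> s))\<^sup>2 < 1" using nz[OF that] by (simp add: sin_squared_eq)
    then have "\<bar>sin (\<theta> s)\<bar> < 1" by (simp add: abs_square_less_1)
    then show ?thesis using vpos[OF that] by (simp add: v'I[OF that] abs_mult)
  qed
  have "maximal_profile (1 + c) I y z v v' \<sigma>"
  proof
    show "(y has_real_derivative \<sigma> * sqrt ((v s)\<^sup>2 - (v' s)\<^sup>2) / (v s)\<^sup>2) (at s)" if "s \<in> I" for s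
    proof -
      have "sqrt ((v s)\<^sup>2 - (v' s)\<^sup>2) / (v s)\<^sup>2 = sqrt (1 - (v' s / v s)\<^sup>2) / v s"
        using sqrt_one_minus_ratio[OF vpos[OF that]] by simp
      also have "1 - (v' s / v s)\<^sup>2 = (\<sigma> * cos (\<theta> s))\<^sup>2"
        using \<sigma>(1) vpos[OF that] by (auto simp: v'I[OF that] cos_squared_eq)
      also have "sqrt ((\<sigma> * cos (\<theta> s))\<^sup>2) / v s = exp (z s) * (\<sigma> * cos (\<theta> s))"
        using \<sigma>(2)[OF that]
        by (simp only: real_sqrt_abs abs_of_pos vI[OF that] exp_minus) (simp add: field_simps)
      finally have "\<sigma> * sqrt ((v s)\<^sup>2 - (v' s)\<^sup>2) / (v s)\<^sup>2 = exp (z s) * cos (\<theta> s)"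
        using \<sigma>(1) by auto
      then show ?thesis using sol(4)[OF that] by simp
    qed
    show "J = I" if J: "open J" "is_interval J" "I \<subseteq> J" "\<forall>s\<in>J. \<bar>v' s\<bar> < v s" for J
    proof -
      obtain y' z' \<theta>' where "const_Kext_solution c J y' z' \<theta>'"
        "\<And>s. s \<in> I \<Longrightarrow> y' s = y s \<and> z' s = z s \<and> \<theta>' s = \<theta> s"
        using extend_solution[OF cs v vI v'I \<sigma> J(1-3)] J(4) by blast
      then show ?thesis
        using max J(3) unfolding maximal_const_Kext_solution_def by blast
    qed
  qed (use sol v cone vI \<sigma> in auto)
  then show thesis by (rule that)
qed

lemma eq_up_to_constantsI:
  assumes "\<epsilon> \<in> {1, -1}" "\<sigma> \<in> {1, -1}" and J: "J = {s. \<epsilon> * s + t \<in> I}"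
    and \<beta>: "\<And>s. s \<in> J \<Longrightarrow> \<beta> s = vector [0, \<sigma> * exp (- l) * y (\<epsilon> * s + t) + b, z (\<epsilon> * s + t) - l]"
  shows "eq_up_to_constants (generating_curve y z) I \<beta> J"
proof -
  define boost :: "real^3 \<Rightarrow> real^3" where
    "boost = (\<lambda>p. vector [exp l * p$1, exp (- l) * p$2, p$3 - l])"
  define trans :: "real^3 \<Rightarrow> real^3" where "trans = (\<lambda>p. vector [p$1, p$2 + b, p$3])"
  define refl :: "real^3 \<Rightarrow> real^3" where "refl = (\<lambda>p. vector [p$1, - (p$2), p$3])"
  have "trans \<circ> boost \<in> sol_constants_group" "trans \<circ> (refl \<circ> boost) \<in> sol_constants_group"
    unfolding trans_def refl_def boost_def by (intro sol_constants_group.intros)+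
  then obtain \<Phi> where \<Phi>: "\<Phi> \<in> sol_constants_group"
    "\<And>p q r. \<Phi> (vector [p, q, r]) = vector [exp l * p, \<sigma> * exp (- l) * q + b, r - l]"
    using assms(2) by (elim insertE emptyE) (fastforce simp: trans_def refl_def boost_def)+
  show ?thesis
    unfolding eq_up_to_constants_def generating_curve_def
    by (rule bexI[of _ \<Phi>], rule bexI[of _ \<epsilon>], rule exI[of _ t], rule conjI[OF J])
       (use \<Phi> assms(1) \<beta> in simp_all)
qed

text \<open>
Reversing the parameter and reflecting \<open>y\<close> lets later arguments assume that \<open>y\<close> increases and that
a given end of the curve is the left one.
\<close>

lemma (in maximal_profile) transform:
  assumes "\<epsilon> \<in> {1, -1}" "\<sigma> \<in> {1, -1}"
  shows "maximal_profile k {s. \<epsilon> * s \<in> I} (\<lambda>s. \<sigma> * y (\<epsilon> * s) + b) (\<lambda>s. z (\<epsilon> * s))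
    (\<lambda>s. v (\<epsilon> * s)) (\<lambda>s. \<epsilon> * v' (\<epsilon> * s)) (\<sigma> * \<epsilon> * \<eta>)"
proof
  have \<epsilon>\<epsilon>: "\<epsilon> * (\<epsilon> * s) = s" for s using assms(1) by auto
  have op: "open {s. \<epsilon> * s \<in> A}" if "open A" for A
    using open_vimage[OF that, of "\<lambda>s. \<epsilon> * s"] by (simp add: vimage_def continuous_on_mult_left)
  have int: "is_interval {s. \<epsilon> * s \<in> A}" if "is_interval A" for A
    unfolding is_interval_1
  proof (intro ballI allI impI)
    fix p q r assume *: "p \<in> {s. \<epsilon> * s \<in> A}" "q \<in> {s. \<epsilon> * s \<in> A}" "p \<le> r \<and> r \<le> q"
    then have "\<epsilon> * r \<in> closed_segment (\<epsilon> * p) (\<epsilon> * q)"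
      using assms(1) by (auto simp: closed_segment_eq_real_ivl)
    then show "r \<in> {s. \<epsilon> * s \<in> A}"
      using * closed_segment_subset[of "\<epsilon> * p" A "\<epsilon> * q"] that by (auto simp: is_interval_convex_1)
  qed
  have scale: "((\<lambda>s. \<epsilon> * s) has_real_derivative \<epsilon>) (at s)" for s
    by (auto intro!: derivative_eq_intros)
  show "open {s. \<epsilon> * s \<in> I}" "is_interval {s. \<epsilon> * s \<in> I}" using op int I by auto
  show "{s. \<epsilon> * s \<in> I} \<noteq> {}" using I(3) \<epsilon>\<epsilon> by (metis (mono_tags) empty_iff ex_in_conv mem_Collect_eq)
  show "((\<lambda>s. v (\<epsilon> * s)) has_real_derivative \<epsilon> * v' (\<epsilon> * s)) (at s)" for s
    by (rule DERIV_chain'[OF scale v(1), THEN DERIV_cong]) simp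
  show "((\<lambda>s. \<epsilon> * v' (\<epsilon> * s)) has_real_derivative k * v (\<epsilon> * s)) (at s)" for s
    using DERIV_cmult[OF DERIV_chain'[OF scale v(2)], of \<epsilon>] assms(1) by auto
  show "\<bar>\<epsilon> * v' (\<epsilon> * s)\<bar> < v (\<epsilon> * s)" if "s \<in> {s. \<epsilon> * s \<in> I}" for s
    using cone[of "\<epsilon> * s"] that assms(1) by auto
  show "z (\<epsilon> * s) = - ln (v (\<epsilon> * s))" if "s \<in> {s. \<epsilon> * s \<in> I}" for s
    using z that by simp
  show "((\<lambda>s. \<sigma> * y (\<epsilon> * s) + b) has_real_derivative
      \<sigma> * \<epsilon> * \<eta> * sqrt ((v (\<epsilon> * s))\<^sup>2 - (\<epsilon> * v' (\<epsilon> * s))\<^sup>2) / (v (\<epsilon> * s))\<^sup>2) (at s)"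
    if "s \<in> {s. \<epsilon> * s \<in> I}" for s
  proof -
    have "(\<epsilon> * v' (\<epsilon> * s))\<^sup>2 = (v' (\<epsilon> * s))\<^sup>2" using assms(1) by auto
    then show ?thesis
      using DERIV_add[OF DERIV_cmult[OF DERIV_chain'[OF scale y[of "\<epsilon> * s"]], of \<sigma>] DERIV_const[of b]] that
      by (simp add: mult_ac)
  qed
  show "\<sigma> * \<epsilon> * \<eta> \<in> {1, -1}" using assms \<eta> by auto
  show "J = {s. \<epsilon> * s \<in> I}" if J: "open J" "is_interval J" "{s. \<epsilon> * s \<in> I} \<subseteq> J"
    "\<forall>s\<in>J. \<bar>\<epsilon> * v' (\<epsilon> * s)\<bar> < v (\<epsilon> * s)" for J
  proof -
    have "{s. \<epsilon> * s \<in> J} = I"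
    proof (rule maximal)
      show "I \<subseteq> {s. \<epsilon> * s \<in> J}"
      proof
        fix s assume "s \<in> I"
        then have "\<epsilon> * (\<epsilon> * s) \<in> I" by (simp only: \<epsilon>\<epsilon>)
        then show "s \<in> {s. \<epsilon> * s \<in> J}" using J(3) by blast
      qed
      show "\<forall>s\<in>{s. \<epsilon> * s \<in> J}. \<bar>v' s\<bar> < v s"
      proof
        fix s assume "s \<in> {s. \<epsilon> * s \<in> J}"
        then have "\<bar>\<epsilon> * v' (\<epsilon> * (\<epsilon> * s))\<bar> < v (\<epsilon> * (\<epsilon> * s))" using J(4) by blast
        then show "\<bar>v' s\<bar> < v s" using assms(1) by (auto simp: abs_mult)
      qed
    qed (use op int J in auto)
    then have "J = {s. \<epsilon> * (\<epsilon> * s) \<in> J}" and I: "I = {s. \<epsilon> * s \<in> J}" by (simp_all only: \<epsilon>\<epsilon>) simp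
    then show ?thesis by (subst I) simp
  qed
qed

section \<open>Curves that are graphs\<close>

lemma bounded_open_interval:
  fixes A :: "real set"
  assumes "open A" "is_interval A" "bounded A" "A \<noteq> {}"
  obtains m M where "m < M" "A = {m<..<M}"
proof -
  have bdd: "bdd_above A" "bdd_below A" using assms(3) by (auto simp: bounded_imp_bdd_above bounded_imp_bdd_below)
  have le: "Inf A \<le> s" "s \<le> Sup A" if "s \<in> A" for s
    using that bdd by (auto intro: cInf_lower cSup_upper)
  then have "\<forall>s\<in>A. Inf A - 1 < s" "\<forall>s\<in>A. s < Sup A + 1" by force+
  then have "Inf A \<notin> A" "Sup A \<notin> A"
    using Inf_notin_open[OF assms(1)] Sup_notin_open[OF assms(1)] by blast+
  with le have sub: "A \<subseteq> {Inf A<..<Sup A}" by (force simp: less_le)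
  moreover have "{Inf A<..<Sup A} \<subseteq> A"
  proof
    fix s assume "s \<in> {Inf A<..<Sup A}"
    then have s: "Inf A < s" "s < Sup A" by auto
    obtain p q where "p \<in> A" "p < s" "q \<in> A" "s < q"
      using s assms(4) bdd by (meson cInf_less_iff less_cSup_iff)
    then show "s \<in> A" using assms(2)[unfolded is_interval_1] by (meson less_imp_le)
  qed
  moreover have "Inf A < Sup A" using sub assms(4) by auto
  ultimately show thesis using that by blast
qed

lemma strict_mono_on_interval:
  fixes f :: "real \<Rightarrow> real"
  assumes "is_interval I" and d: "\<And>s. s \<in> I \<Longrightarrow> (f has_real_derivative f' s) (at s)" "\<And>s. s \<in> I \<Longrightarrow> f' s > 0"
    and "s \<in> I" "t \<in> I" "s < t"
  shows "f s < f t"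
proof (rule DERIV_pos_imp_increasing[OF \<open>s < t\<close>])
  fix r assume "s \<le> r" "r \<le> t"
  then have "r \<in> I" using assms(1,4,5) unfolding is_interval_1 by blast
  then show "\<exists>D. (f has_real_derivative D) (at r) \<and> D > 0" using d by blast
qed

lemma increasing_image_open_interval:
  fixes f :: "real \<Rightarrow> real"
  assumes "open I" "is_interval I" "continuous_on I f" "\<And>s t. s \<in> I \<Longrightarrow> t \<in> I \<Longrightarrow> s < t \<Longrightarrow> f s < f t"
  shows "open (f ` I)" "is_interval (f ` I)"
proof -
  show int: "is_interval (f ` I)"
    using assms(2,3) by (simp add: is_interval_connected_1 connected_continuous_image)
  show "open (f ` I)"
  proof (rule openI)
    fix x assume "x \<in> f ` I"
    then obtain s where s: "s \<in> I" "x = f s" by blast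
    obtain e where e: "e > 0" "ball s e \<subseteq> I" using assms(1) s(1) open_contains_ball by blast
    then have pm: "s - e/2 \<in> I" "s + e/2 \<in> I" by (auto intro!: subsetD[OF e(2)] simp: dist_real_def)
    have lt: "f (s - e/2) < x" "x < f (s + e/2)" using assms(4) pm s e(1) by auto
    have "{f (s - e/2)<..<f (s + e/2)} \<subseteq> f ` I"
    proof
      fix w assume "w \<in> {f (s - e/2)<..<f (s + e/2)}"
      then have "f (s - e/2) \<le> w" "w \<le> f (s + e/2)" by auto
      with int pm show "w \<in> f ` I" unfolding is_interval_1 by blast
    qed
    moreover have "x \<in> {f (s - e/2)<..<f (s + e/2)}" using lt by simp
    ultimately show "\<exists>e>0. ball x e \<subseteq> f ` I"
      by (meson open_contains_ball open_greaterThanLessThan order_trans)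
  qed
qed

text \<open>
A curve along which \<open>y\<close> increases is a graph. The ends of the interval of \<open>y\<close>-values
correspond to the ends of the parameter interval, so limits along the graph may be computed along
the curve.
\<close>

locale graph_curve =
  fixes I :: "real set" and y z :: "real \<Rightarrow> real" and f :: "real \<Rightarrow> real" and m M :: real
  assumes mono: "s \<in> I \<Longrightarrow> t \<in> I \<Longrightarrow> s < t \<Longrightarrow> y s < y t"
    and image: "y ` I = {m<..<M}"
    and graph: "s \<in> I \<Longrightarrow> f (y s) = z s"
begin

lemma is_graph: "is_graph_of (generating_curve y z) I f {m<..<M}"
  unfolding is_graph_of_def image[symmetric] generating_curve_def Setcompr_eq_image image_image
  using graph by (intro image_cong) auto

lemma less_iff: "s \<in> I \<Longrightarrow> t \<in> I \<Longrightarrow> y s < y t \<longleftrightarrow> s < t"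
  using mono by (metis less_asym linorder_neqE_linordered_idom less_irrefl)

lemma preimage: "x \<in> {m<..<M} \<Longrightarrow> \<exists>s\<in>I. x = y s"
  using image by blast

lemma asymptotic_left:
  assumes "\<And>R. \<exists>t\<in>I. \<forall>s\<in>I. s < t \<longrightarrow> R \<le> \<bar>z s\<bar>"
  shows "asymptotic_to_line f {m<..<M} m"
  unfolding asymptotic_to_line_def filterlim_at_top
proof
  fix R
  obtain t where t: "t \<in> I" "\<And>s. s \<in> I \<Longrightarrow> s < t \<Longrightarrow> R \<le> \<bar>z s\<bar>" using assms by blast
  have "m < y t" using t(1) image by auto
  show "\<forall>\<^sub>F x in at m within {m<..<M}. R \<le> \<bar>f x\<bar>"
    unfolding eventually_at
  proof (intro exI[of _ "y t - m"] conjI ballI impI)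
    fix x assume "x \<in> {m<..<M}" "x \<noteq> m \<and> dist x m < y t - m"
    then obtain s where "s \<in> I" "x = y s" "y s < y t" using preimage by (auto simp: dist_real_def)
    then show "R \<le> \<bar>f x\<bar>" using t less_iff graph by auto
  qed (use \<open>m < y t\<close> in simp)
qed

lemma asymptotic_right:
  assumes "\<And>R. \<exists>t\<in>I. \<forall>s\<in>I. t < s \<longrightarrow> R \<le> \<bar>z s\<bar>"
  shows "asymptotic_to_line f {m<..<M} M"
  unfolding asymptotic_to_line_def filterlim_at_top
proof
  fix R
  obtain t where t: "t \<in> I" "\<And>s. s \<in> I \<Longrightarrow> t < s \<Longrightarrow> R \<le> \<bar>z s\<bar>" using assms by blast
  have "y t < M" using t(1) image by auto
  show "\<forall>\<^sub>F x in at M within {m<..<M}. R \<le> \<bar>f x\<bar>"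
    unfolding eventually_at
  proof (intro exI[of _ "M - y t"] conjI ballI impI)
    fix x assume "x \<in> {m<..<M}" "x \<noteq> M \<and> dist x M < M - y t"
    then obtain s where "s \<in> I" "x = y s" "y t < y s" using preimage by (auto simp: dist_real_def)
    then show "R \<le> \<bar>f x\<bar>" using t less_iff graph by auto
  qed (use \<open>y t < M\<close> in simp)
qed

lemma limit_left:
  fixes g :: "real \<Rightarrow> real"
  assumes "\<And>e. e > 0 \<Longrightarrow> \<exists>t\<in>I. \<forall>s\<in>I. s < t \<longrightarrow> dist (g s) l < e"
  shows "(g \<longlongrightarrow> l) (inf (filtercomap y (nhds m)) (principal I))"
proof (rule tendstoI)
  fix e :: real assume "e > 0"
  then obtain t where t: "t \<in> I" "\<And>s. s \<in> I \<Longrightarrow> s < t \<Longrightarrow> dist (g s) l < e" using assms by blast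
  have "\<forall>\<^sub>F x in nhds m. x < y t"
    by (rule order_tendstoD(2)[OF tendsto_ident_at[of m UNIV], THEN eventually_nhds_conv_at[THEN iffD2, OF conjI]])
       (use t(1) image in auto)
  then have "\<forall>\<^sub>F s in filtercomap y (nhds m). y s < y t" by (rule eventually_filtercomapI)
  then show "\<forall>\<^sub>F s in inf (filtercomap y (nhds m)) (principal I). dist (g s) l < e"
    unfolding eventually_inf_principal by eventually_elim (use t less_iff in auto)
qed

lemma limit_right:
  fixes g :: "real \<Rightarrow> real"
  assumes "\<And>e. e > 0 \<Longrightarrow> \<exists>t\<in>I. \<forall>s\<in>I. t < s \<longrightarrow> dist (g s) l < e"
  shows "(g \<longlongrightarrow> l) (inf (filtercomap y (nhds M)) (principal I))"
proof (rule tendstoI)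
  fix e :: real assume "e > 0"
  then obtain t where t: "t \<in> I" "\<And>s. s \<in> I \<Longrightarrow> t < s \<Longrightarrow> dist (g s) l < e" using assms by blast
  have "\<forall>\<^sub>F x in nhds M. y t < x"
    by (rule eventually_nhds_in_open[of "{y t<..}" M, simplified])
       (use t(1) image in auto)
  then have "\<forall>\<^sub>F s in filtercomap y (nhds M). y t < y s" by (rule eventually_filtercomapI)
  then show "\<forall>\<^sub>F s in inf (filtercomap y (nhds M)) (principal I). dist (g s) l < e"
    unfolding eventually_inf_principal by eventually_elim (use t less_iff in auto)
qed

end

text \<open>
The sign \<open>\<tau>\<close> treats a minimum (\<open>\<tau> = 1\<close>) and a maximum (\<open>\<tau> = -1\<close>) at once. At any other point
\<open>f\<close> is strictly monotone, hence takes both larger and smaller values nearby.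
\<close>

lemma single_max_or_minI:
  fixes f :: "real \<Rightarrow> real"
  assumes "\<tau> \<in> {1, -1}" "p \<in> {a<..<b}"
    and left: "\<And>x x'. a < x \<Longrightarrow> x < x' \<Longrightarrow> x' \<le> p \<Longrightarrow> \<tau> * f x' < \<tau> * f x"
    and right: "\<And>x x'. p \<le> x \<Longrightarrow> x < x' \<Longrightarrow> x' < b \<Longrightarrow> \<tau> * f x < \<tau> * f x'"
  shows "single_max_or_min f {a<..<b}"
  unfolding single_max_or_min_def
proof (intro bexI[of _ p] conjI ballI impI)
  have "\<tau> * f p < \<tau> * f x" if "x \<in> {a<..<b} - {p}" for x
    using that left[of x p] right[of p x] by (cases x p rule: linorder_cases) auto
  with assms(1) show "(\<forall>q\<in>{a<..<b} - {p}. f q < f p) \<or> (\<forall>q\<in>{a<..<b} - {p}. f p < f q)"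
    by (elim insertE emptyE) simp_all
next
  fix x assume x: "x \<in> {a<..<b}" "local_extremum f x"
  have ext: "\<exists>d>0. \<forall>\<rho>\<in>{1, -1}. \<forall>e. 0 < e \<and> e < d \<longrightarrow> \<sigma> * f (x + \<rho> * e) \<le> \<sigma> * f x"
    if ev: "\<forall>\<^sub>F q in at x. \<sigma> * f q \<le> \<sigma> * f x" for \<sigma>
  proof -
    obtain d where "d > 0 \<and> (\<forall>q\<in>UNIV. q \<noteq> x \<and> dist q x < d \<longrightarrow> \<sigma> * f q \<le> \<sigma> * f x)"
      using ev unfolding eventually_at by blast
    then have d: "d > 0" "\<forall>q\<in>UNIV. q \<noteq> x \<and> dist q x < d \<longrightarrow> \<sigma> * f q \<le> \<sigma> * f x" by simp_all
    have "\<sigma> * f (x + \<rho> * e) \<le> \<sigma> * f x" if "\<rho> \<in> {1, -1}" "0 < e \<and> e < d" for \<rho> e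
      using that by (intro d(2)[rule_format]) (auto simp: dist_real_def)
    with d(1) show ?thesis by blast
  qed
  have "\<exists>\<sigma>\<in>{1, -1}. \<forall>\<^sub>F q in at x. \<sigma> * f q \<le> \<sigma> * f x"
    using x(2) unfolding local_extremum_def by auto
  then obtain \<sigma> where \<sigma>: "\<sigma> \<in> {1, -1}" and ev: "\<forall>\<^sub>F q in at x. \<sigma> * f q \<le> \<sigma> * f x" ..
  obtain d where d: "d > 0"
    "\<forall>\<rho>\<in>{1, -1}. \<forall>e. 0 < e \<and> e < d \<longrightarrow> \<sigma> * f (x + \<rho> * e) \<le> \<sigma> * f x"
    using ext[OF ev] by (elim exE conjE)
  show "x = p"
  proof (rule ccontr)
    assume "x \<noteq> p"
    define \<mu> where "\<mu> = min d (min \<bar>x - p\<bar> (min (x - a) (b - x)))"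
    have \<mu>: "0 < \<mu>" "\<mu> \<le> d" "\<mu> \<le> \<bar>x - p\<bar>" "\<mu> \<le> x - a" "\<mu> \<le> b - x"
      using d(1) x(1) \<open>x \<noteq> p\<close> by (auto simp: \<mu>_def)
    define e where "e = \<mu> / 2"
    have e: "0 < e" "e < d" "e < \<bar>x - p\<bar>" "e < x - a" "e < b - x"
      unfolding e_def using \<mu> by linarith+
    have 1: "\<sigma> * f (x + e) \<le> \<sigma> * f x" "\<sigma> * f (x - e) \<le> \<sigma> * f x"
      using d(2)[rule_format, of 1 e] d(2)[rule_format, of "-1" e] e by auto
    show False
    proof (cases "x < p")
      case True
      then have "\<tau> * f x < \<tau> * f (x - e)" "\<tau> * f (x + e) < \<tau> * f x"
        using e by (auto intro!: left)
      with 1 \<sigma> assms(1) show False by auto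
    next
      case False
      then have "\<tau> * f (x - e) < \<tau> * f x" "\<tau> * f x < \<tau> * f (x + e)"
        using e \<open>x \<noteq> p\<close> by (auto intro!: right)
      with 1 \<sigma> assms(1) show False by auto
    qed
  qed
qed (use assms(2) in auto)

section \<open>Geometry of profiles\<close>

context maximal_profile
begin

lemma vpos: "s \<in> I \<Longrightarrow> v s > 0"
  using cone[of s] by linarith

lemma z_deriv: "(z has_real_derivative - v' s / v s) (at s)" if "s \<in> I"
proof (rule has_field_derivative_transform_within_open[OF _ I(1) that])
  show "((\<lambda>s. - ln (v s)) has_real_derivative - v' s / v s) (at s)"
    by (rule derivative_eq_intros v refl | use vpos[OF that] in simp)+
qed (simp add: z)

lemma speed_pos: "sqrt ((v s)\<^sup>2 - (v' s)\<^sup>2) / (v s)\<^sup>2 > 0" if "s \<in> I"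
proof -
  have "(v' s)\<^sup>2 < (v s)\<^sup>2" 
    using power_strict_mono[OF cone[OF that], of 2] by simp
  then show ?thesis using vpos[OF that] by simp
qed

text \<open>
The way to read off the domain from an explicit profile: a connected set \<open>\<bar>v'\<bar> < v\<close> is itself
an admissible extension of \<open>I\<close>.
\<close>

lemma interval_cone: "I = {s. \<bar>v' s\<bar> < v s}" if "is_interval {s. \<bar>v' s\<bar> < v s}"
proof (rule maximal[symmetric])
  have "continuous_on UNIV v" "continuous_on UNIV v'"
    by (rule continuous_at_imp_continuous_on, blast intro: DERIV_isCont v)+
  then show "open {s. \<bar>v' s\<bar> < v s}"
    by (intro open_Collect_less continuous_intros)
qed (use cone that in auto)

lemma y_increasing: "y s < y t" if "\<eta> = 1" "s \<in> I" "t \<in> I" "s < t"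
  by (rule strict_mono_on_interval[OF I(2) y _ that(2-4)])
     (use speed_pos that(1) in simp_all)

lemma graph_curve_exists:
  assumes "\<eta> = 1" "bounded (y ` I)"
  obtains f m M where "m < M" "graph_curve I y z f m M"
proof -
  have "continuous_on I y"
    by (rule continuous_at_imp_continuous_on) (blast intro: DERIV_isCont y)
  note im = increasing_image_open_interval[OF I(1,2) this y_increasing[OF assms(1)]]
  obtain m M where mM: "m < M" "y ` I = {m<..<M}"
    using bounded_open_interval[OF im assms(2)] I(3) by blast
  have "inj_on y I"
    using y_increasing[OF assms(1)] by (intro linorder_inj_onI') (metis less_irrefl)
  then have "graph_curve I y z (\<lambda>x. z (inv_into I y x)) m M"
    using mM(2) by unfold_locales (auto simp: y_increasing[OF assms(1)])
  with mM(1) that show thesis by blast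
qed

text \<open>
The bound \<open>y' \<le> 1 / v\<close> and an exponential lower bound for \<open>v\<close> control \<open>y\<close>. With
\<open>\<rho> > 0\<close> it bounds the oscillation of \<open>y\<close> towards \<open>s = - \<infinity>\<close>, with \<open>\<rho> < 0\<close> towards \<open>s = \<infinity>\<close>.
\<close>

lemma y_increment:
  assumes "\<eta> = 1" "s \<in> I" "t \<in> I" "s \<le> t" "\<kappa> > 0" "\<rho> \<noteq> 0"
    and lower: "\<And>r. r \<in> I \<Longrightarrow> \<kappa> * exp (- \<rho> * r) \<le> v r"
  shows "y t - y s \<le> (exp (\<rho> * t) - exp (\<rho> * s)) / (\<kappa> * \<rho>)"
proof -
  have "y t - exp (\<rho> * t) / (\<kappa> * \<rho>) \<le> y s - exp (\<rho> * s) / (\<kappa> * \<rho>)"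
  proof (rule DERIV_nonpos_imp_nonincreasing[OF \<open>s \<le> t\<close>])
    fix r assume "s \<le> r" "r \<le> t"
    then have r: "r \<in> I" using I(2) assms(2,3) unfolding is_interval_1 by blast
    have "sqrt ((v r)\<^sup>2 - (v' r)\<^sup>2) \<le> sqrt ((v r)\<^sup>2)"
      by (rule real_sqrt_le_mono) simp
    then have "sqrt ((v r)\<^sup>2 - (v' r)\<^sup>2) / (v r)\<^sup>2 \<le> v r / (v r)\<^sup>2"
      using vpos[OF r] by (intro divide_right_mono) simp_all
    also have "\<dots> = 1 / v r" using vpos[OF r] by (simp add: power2_eq_square)
    also have "\<dots> \<le> 1 / (\<kappa> * exp (- \<rho> * r))"
      using lower[OF r] assms(5) by (intro divide_left_mono) (simp_all add: vpos[OF r])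
    also have "\<dots> = exp (\<rho> * r) / \<kappa>" by (simp add: exp_minus field_simps)
    finally have "1 * sqrt ((v r)\<^sup>2 - (v' r)\<^sup>2) / (v r)\<^sup>2 - exp (\<rho> * r) / \<kappa> \<le> 0" by simp
    moreover have "((\<lambda>r. exp (\<rho> * r) / (\<kappa> * \<rho>)) has_real_derivative exp (\<rho> * r) / \<kappa>) (at r)"
      using assms(5,6) by (auto intro!: derivative_eq_intros)
    ultimately show "\<exists>D. ((\<lambda>r. y r - exp (\<rho> * r) / (\<kappa> * \<rho>)) has_real_derivative D) (at r) \<and> D \<le> 0"
      using DERIV_diff[OF y[OF r]] unfolding assms(1) by blast
  qed
  then show ?thesis by (simp add: diff_divide_distrib)
qed

lemma exponential_form:
  assumes "w > 0" "k = w\<^sup>2"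
  obtains a b where "\<And>s. v s = (a * exp (w * s) + b * exp (- w * s)) / (2 * w)"
    "\<And>s. v' s = (a * exp (w * s) - b * exp (- w * s)) / 2"
proof -
  \<comment> \<open>The combinations \<open>v' + w v\<close> and \<open>w v - v'\<close> solve first-order equations with rates \<open>w\<close> and \<open>- w\<close>.\<close>
  define a where "a = v' 0 + w * v 0"
  define b where "b = w * v 0 - v' 0"
  have "(v' s + w * v s) / exp (w * s) = a" for s
  proof (rule eq_on_open_interval[of UNIV 0 _ "\<lambda>_. a" s "\<lambda>_. 0"])
    show "((\<lambda>s. (v' s + w * v s) / exp (w * s)) has_real_derivative 0) (at s)" for s
      by (rule derivative_eq_intros v refl)+ (simp_all add: assms(2) algebra_simps power2_eq_square)
  qed (simp_all add: a_def)
  then have a: "v' s + w * v s = a * exp (w * s)" for s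
    by (metis exp_not_eq_zero nonzero_divide_eq_eq)
  have "(w * v s - v' s) / exp (- w * s) = b" for s
  proof (rule eq_on_open_interval[of UNIV 0 _ "\<lambda>_. b" s "\<lambda>_. 0"])
    show "((\<lambda>s. (w * v s - v' s) / exp (- w * s)) has_real_derivative 0) (at s)" for s
      by (rule derivative_eq_intros v refl)+ (simp_all add: assms(2) algebra_simps power2_eq_square)
  qed (simp_all add: b_def)
  then have b: "w * v s - v' s = b * exp (- w * s)" for s
    by (metis exp_not_eq_zero nonzero_divide_eq_eq)
  show thesis
  proof (rule that[of a b])
    show "v s = (a * exp (w * s) + b * exp (- w * s)) / (2 * w)" for s
      unfolding a[symmetric] b[symmetric] using assms(1) by (simp add: field_simps)
    show "v' s = (a * exp (w * s) - b * exp (- w * s)) / 2" for s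
      unfolding a[symmetric] b[symmetric] by (simp add: field_simps)
  qed
qed

end

section \<open>Explicit curves: curvature zero and minus one\<close>

context maximal_profile
begin

text \<open>
For \<open>k = 1\<close> the quantity \<open>v\<^sup>2 - v'\<^sup>2 = a b\<close> is constant, and it is positive on \<open>I\<close>. Hence \<open>v\<close> is a
shifted multiple \<open>r cosh\<close> of the hyperbolic cosine, and \<open>y' = \<eta> r / v\<^sup>2\<close> integrates to \<open>tanh\<close>.
The boost removes \<open>r\<close>.
\<close>

lemma zero_curvature_case:
  assumes "k = 1"
  shows "eq_up_to_constants (generating_curve y z) I (\<lambda>s. vector [0, tanh s, - ln (cosh s)]) UNIV"
proof -
  obtain a b where ab: "\<And>s. v s = (a * exp s + b * exp (- s)) / 2" "\<And>s. v' s = (a * exp s - b * exp (- s)) / 2"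
    using exponential_form[of 1] assms(1) by auto
  obtain s1 where s1: "s1 \<in> I" using I(3) by blast
  have abpos: "a * b > 0"
  proof -
    have "(v s1)\<^sup>2 - (v' s1)\<^sup>2 = a * b * (exp s1 * exp (- s1))"
      unfolding ab power2_eq_square by (simp add: field_simps)
    also have "exp s1 * exp (- s1) = 1" by (simp flip: exp_add)
    finally have "(v s1)\<^sup>2 - (v' s1)\<^sup>2 = a * b" by simp
    moreover have "(v' s1)\<^sup>2 < (v s1)\<^sup>2"
      using power_strict_mono[OF cone[OF s1], of 2] by simp
    ultimately show ?thesis by simp
  qed
  have "a > 0 \<and> b > 0"
  proof (rule ccontr)
    assume "\<not> ?thesis"
    then have "a < 0" "b < 0" using abpos by (auto simp: zero_less_mult_iff)
    then have "v s1 < 0" unfolding ab by (simp add: add_neg_neg mult_neg_pos)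
    then show False using vpos[OF s1] by simp
  qed
  then have a: "a > 0" and b: "b > 0" by auto
  have UNIV: "I = UNIV"
  proof -
    have "\<bar>v' s\<bar> < v s" for s
      unfolding ab using a b by (auto simp: abs_less_iff field_simps)
    then show ?thesis using interval_cone by simp
  qed
  \<comment> \<open>The shift \<open>t\<close> moves the minimum of \<open>v\<close> to the origin; it makes both exponential coefficients equal to \<open>r\<close>.\<close>
  define r where "r = sqrt (a * b)"
  define t where "t = ln (b / a) / 2"
  have r: "r > 0" "r\<^sup>2 = a * b" using abpos by (auto simp: r_def)
  have et: "(exp t)\<^sup>2 = b / a" using a b by (simp add: t_def flip: exp_double)
  have at: "a * exp t = r"
  proof -
    have "(a * exp t)\<^sup>2 = r\<^sup>2"
      unfolding power_mult_distrib et r(2) using a by (simp add: power2_eq_square)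
    then show ?thesis using r(1) a by (subst (asm) power2_eq_iff_nonneg) auto
  qed
  have bt: "b * exp (- t) = r"
  proof -
    have "r * (b * exp (- t)) = (a * exp t) * (b * exp (- t))" by (simp only: at)
    also have "\<dots> = a * b * (exp t * exp (- t))" by (simp only: mult_ac)
    also have "\<dots> = r * r" using r(2) by (simp add: power2_eq_square flip: exp_add)
    finally show ?thesis using r(1) by simp
  qed
  have vt: "v (s + t) = r * cosh s" and v't: "v' (s + t) = r * sinh s" for s
  proof -
    have "a * exp (s + t) = (a * exp t) * exp s" "b * exp (- (s + t)) = (b * exp (- t)) * exp (- s)"
      by (simp_all add: exp_add exp_diff exp_minus field_simps)
    then have exps: "a * exp (s + t) = r * exp s" "b * exp (- (s + t)) = r * exp (- s)"
      unfolding at bt by auto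
    show "v (s + t) = r * cosh s" "v' (s + t) = r * sinh s"
      unfolding ab[of "s + t"] exps cosh_field_def sinh_field_def by (simp_all add: algebra_simps)
  qed
  have yt: "y (s + t) = \<eta> / r * tanh s + y t" for s
  proof (rule eq_on_open_interval[of UNIV 0 "\<lambda>s. y (s + t)" "\<lambda>s. \<eta> / r * tanh s + y t" s
        "\<lambda>s. \<eta> / (r * (cosh s)\<^sup>2)"])
    show "((\<lambda>s. y (s + t)) has_real_derivative \<eta> / (r * (cosh s)\<^sup>2)) (at s)" for s
    proof -
      have "(v (s + t))\<^sup>2 - (v' (s + t))\<^sup>2 = r\<^sup>2"
        unfolding vt v't by (simp add: power_mult_distrib cosh_square_eq algebra_simps)
      then have "\<eta> * sqrt ((v (s + t))\<^sup>2 - (v' (s + t))\<^sup>2) / (v (s + t))\<^sup>2 = \<eta> / (r * (cosh s)\<^sup>2)"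
        using r(1) by (simp add: vt power_mult_distrib power2_eq_square)
      then show ?thesis using y[of "s + t"] UNIV by (simp add: DERIV_shift)
    qed
    show "((\<lambda>s. \<eta> / r * tanh s + y t) has_real_derivative \<eta> / (r * (cosh s)\<^sup>2)) (at s)" for s
    proof -
      have "1 - (tanh s)\<^sup>2 = ((cosh s)\<^sup>2 - (sinh s)\<^sup>2) / (cosh s)\<^sup>2"
        by (simp add: tanh_def power_divide diff_divide_distrib)
      also have "(cosh s)\<^sup>2 - (sinh s)\<^sup>2 = 1" by (simp add: cosh_square_eq)
      finally have "1 - (tanh s)\<^sup>2 = 1 / (cosh s)\<^sup>2" .
      then show ?thesis
        by (intro DERIV_cong[OF DERIV_add[OF DERIV_cmult[OF has_field_derivative_tanh[OF _ DERIV_ident]] DERIV_const]])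
           simp_all
    qed
  qed auto
  have zt: "z (s + t) = - ln r - ln (cosh s)" for s
    using z[of "s + t"] UNIV r(1) by (simp add: vt ln_mult)
  show ?thesis
    using r(1) \<eta> UNIV
    by (intro eq_up_to_constantsI[of 1 \<eta> _ t _ _ "- ln r" _ "- \<eta> * r * y t"])
       (auto simp: yt zt field_simps)
qed

lemma constant_slope_case:
  assumes "k = 0"
  obtains A B where "\<And>s. v s = A + B * s" "\<And>s. v' s = B"
proof -
  have v': "v' s = v' 0" for s
    by (rule eq_on_open_interval[of UNIV 0 _ "\<lambda>_. v' 0" s "\<lambda>_. 0"])
       (use v(2) assms in simp_all)
  have "v s = v 0 + v' 0 * s" for s
    by (rule eq_on_open_interval[of UNIV 0 _ "\<lambda>s. v 0 + v' 0 * s" s v'])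
       (auto intro!: derivative_eq_intros v simp: v'[symmetric])
  then show thesis using that v' by blast
qed

text \<open>
For \<open>k = 0\<close> the profile \<open>v = A + B s\<close> is affine. A constant one gives a leaf; otherwise
an affine change of the parameter with slope \<open>\<plusminus> 1\<close> makes it \<open>r s\<close> with \<open>r = \<bar>B\<bar>\<close>, so that \<open>\<bar>v'\<bar> < v\<close>
becomes \<open>s > 1\<close>.
\<close>

lemma curvature_minus_one_case:
  assumes "k = 0"
  shows "invariant_surface I y z \<in> foliation3 \<or>
    eq_up_to_constants (generating_curve y z) I
      (\<lambda>s. vector [0, - (sqrt (s\<^sup>2 - 1) / s) + ln (s + sqrt (s\<^sup>2 - 1)), - ln s]) {1<..}"
proof -
  obtain A B where AB: "\<And>s. v s = A + B * s" "\<And>s. v' s = B"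
    using constant_slope_case[OF assms] by blast
  have int: "is_interval {s. \<bar>v' s\<bar> < v s}"
    unfolding is_interval_1 AB
  proof (intro ballI allI impI)
    fix p q r assume *: "p \<in> {s. \<bar>B\<bar> < A + B * s}" "q \<in> {s. \<bar>B\<bar> < A + B * s}" "p \<le> r \<and> r \<le> q"
    show "r \<in> {s. \<bar>B\<bar> < A + B * s}"
    proof (cases "B \<ge> 0")
      case True
      then have "B * p \<le> B * r" using * by (intro mult_left_mono) auto
      then show ?thesis using * by auto
    next
      case False
      then have "B * q \<le> B * r" using * by (intro mult_left_mono_neg) auto
      then show ?thesis using * by auto
    qed
  qed
  note I_eq = interval_cone[OF int]
  obtain s1 where s1: "s1 \<in> I" using I(3) by blast
  show ?thesis
  proof (cases "B = 0")
    case True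
    have A: "A > 0" using vpos[OF s1] by (simp add: AB True)
    have UNIV: "I = UNIV" unfolding I_eq AB using A True by simp
    have ys: "y s = y 0 + \<eta> / A * s" for s
    proof (rule eq_on_open_interval[of UNIV 0 y "\<lambda>s. y 0 + \<eta> / A * s" s "\<lambda>_. \<eta> / A"])
      show "(y has_real_derivative \<eta> / A) (at s)" for s
        using y[of s] UNIV A by (simp add: AB True power2_eq_square)
    qed (use A in \<open>auto intro!: derivative_eq_intros\<close>)
    have zs: "z s = - ln A" for s using z[of s] UNIV by (simp add: AB True)
    have "invariant_surface I y z = {vector [p, q, - ln A] |p q. True}"
    proof -
      have surj: "\<exists>s. y s = q" for q
        using A \<eta> by (intro exI[of _ "(q - y 0) * A / \<eta>"]) (subst ys, auto)
      have "invariant_surface I y z = {vector [p, y s, - ln A] |s p. True}"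
        unfolding invariant_surface_def invariant_param_def UNIV zs by simp
      also have "\<dots> = {vector [p, q, - ln A] |p q. True}"
      proof (intro Collect_cong iffI)
        fix x :: "real^3"
        assume "\<exists>p q. x = vector [p, q, - ln A] \<and> True"
        then obtain p q where "x = vector [p, q, - ln A]" by blast
        moreover obtain s where "y s = q" using surj by blast
        ultimately show "\<exists>s p. x = vector [p, y s, - ln A] \<and> True" by blast
      qed blast
      finally show ?thesis .
    qed
    then show ?thesis unfolding foliation3_def by blast
  next
    case False
    define \<epsilon> where "\<epsilon> = sgn B"
    define r where "r = \<bar>B\<bar>"
    define t where "t = - A / B"
    have \<epsilon>: "\<epsilon> \<in> {1, -1}" "B * \<epsilon> = r" and r: "r > 0"
      using False by (auto simp: \<epsilon>_def r_def sgn_if)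
    have vt: "v (\<epsilon> * s + t) = r * s" for s
      using False \<epsilon>(2) by (simp add: AB t_def algebra_simps)
    have J: "{1<..} = {s. \<epsilon> * s + t \<in> I}"
      unfolding I_eq mem_Collect_eq vt AB(2) r_def[symmetric] using r by auto
    \<comment> \<open>A primitive of \<open>sqrt (s\<^sup>2 - 1) / s\<^sup>2\<close>, which is \<open>r\<close> times the absolute value of \<open>y'\<close>.\<close>
    define h where "h s = - (sqrt (s\<^sup>2 - 1) / s) + ln (s + sqrt (s\<^sup>2 - 1))" for s :: real
    have h: "(h has_real_derivative sqrt (s\<^sup>2 - 1) / s\<^sup>2) (at s)" if "s > 1" for s
    proof -
      define q where "q = sqrt (s\<^sup>2 - 1)"
      have s2: "s\<^sup>2 > 1" using that by (simp add: one_less_power)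
      have q: "q > 0" "q\<^sup>2 = s\<^sup>2 - 1" using s2 by (auto simp: q_def)
      have "((\<lambda>s. s\<^sup>2 - 1) has_real_derivative 2 * s) (at s)"
        by (auto intro!: derivative_eq_intros)
      from DERIV_chain'[OF this DERIV_real_sqrt]
      have sq: "((\<lambda>s. sqrt (s\<^sup>2 - 1)) has_real_derivative s / q) (at s)"
        using s2 q(1) by (simp add: q_def field_simps)
      have quot: "((\<lambda>s. sqrt (s\<^sup>2 - 1) / s) has_real_derivative (s / q * s - q * 1) / (s * s)) (at s)"
        unfolding q_def by (rule DERIV_divide[OF sq[unfolded q_def] DERIV_ident]) (use that in simp)
      have pos: "0 < s + sqrt (s\<^sup>2 - 1)"
        unfolding q_def[symmetric] using that q(1) by linarith
      have "((\<lambda>s. ln (s + sqrt (s\<^sup>2 - 1))) has_real_derivative (1 + s / q) * inverse (s + q)) (at s)"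
        unfolding q_def
        by (rule DERIV_chain'[OF DERIV_add[OF DERIV_ident sq[unfolded q_def]] DERIV_ln, THEN DERIV_cong])
           (rule pos, simp add: mult.commute)
      then have "(h has_real_derivative - ((s / q * s - q * 1) / (s * s)) + (1 + s / q) / (s + q)) (at s)"
        unfolding h_def[abs_def] divide_inverse[of "1 + s / q"] by (intro DERIV_add DERIV_minus quot)
      moreover have "- ((s / q * s - q * 1) / (s * s)) + (1 + s / q) / (s + q) = q / s\<^sup>2"
      proof -
        have "1 + s / q = (s + q) / q" "s + q \<noteq> 0" using that q(1) by (simp_all add: add_divide_distrib)
        then have "(1 + s / q) / (s + q) = 1 / q" by simp
        moreover have "s / q * s - q * 1 = 1 / q"
          using q by (simp add: field_simps power2_eq_square)
        moreover have "- (1 / q / (s * s)) + 1 / q = (s\<^sup>2 - 1) / (q * s\<^sup>2)"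
          using that q(1) by (simp add: field_simps power2_eq_square)
        moreover have "(s\<^sup>2 - 1) / (q * s\<^sup>2) = q / s\<^sup>2"
          using q(1) unfolding q(2)[symmetric] by (simp add: power2_eq_square)
        ultimately show ?thesis by simp
      qed
      ultimately show ?thesis by (simp add: q_def)
    qed
    have yt: "y (\<epsilon> * s + t) = \<epsilon> * \<eta> / r * h s + (y (\<epsilon> * 2 + t) - \<epsilon> * \<eta> / r * h 2)" if "s > 1" for s
    proof (rule eq_on_open_interval[of "{1<..}" 2 "\<lambda>s. y (\<epsilon> * s + t)"
          "\<lambda>s. \<epsilon> * \<eta> / r * h s + (y (\<epsilon> * 2 + t) - \<epsilon> * \<eta> / r * h 2)" s
          "\<lambda>s. \<epsilon> * \<eta> / r * (sqrt (s\<^sup>2 - 1) / s\<^sup>2)"])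
      show "((\<lambda>s. y (\<epsilon> * s + t)) has_real_derivative \<epsilon> * \<eta> / r * (sqrt (s\<^sup>2 - 1) / s\<^sup>2)) (at s)"
        if "s \<in> {1<..}" for s
      proof -
        have inI: "\<epsilon> * s + t \<in> I" using that J by blast
        have lin: "((\<lambda>s. \<epsilon> * s + t) has_real_derivative \<epsilon>) (at s)"
          by (auto intro!: derivative_eq_intros)
        have "(v (\<epsilon> * s + t))\<^sup>2 - (v' (\<epsilon> * s + t))\<^sup>2 = r\<^sup>2 * (s\<^sup>2 - 1)"
          unfolding vt AB(2) by (simp add: r_def algebra_simps)
        then have "sqrt ((v (\<epsilon> * s + t))\<^sup>2 - (v' (\<epsilon> * s + t))\<^sup>2) = r * sqrt (s\<^sup>2 - 1)"
          using r by (simp add: real_sqrt_mult)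
        then have "\<eta> * sqrt ((v (\<epsilon> * s + t))\<^sup>2 - (v' (\<epsilon> * s + t))\<^sup>2) / (v (\<epsilon> * s + t))\<^sup>2 * \<epsilon>
            = \<epsilon> * \<eta> / r * (sqrt (s\<^sup>2 - 1) / s\<^sup>2)"
          using r by (simp add: vt power_mult_distrib power2_eq_square mult_ac)
        with DERIV_chain'[OF lin y[OF inI]] show ?thesis by simp
      qed
      show "((\<lambda>s. \<epsilon> * \<eta> / r * h s + (y (\<epsilon> * 2 + t) - \<epsilon> * \<eta> / r * h 2)) has_real_derivative
          \<epsilon> * \<eta> / r * (sqrt (s\<^sup>2 - 1) / s\<^sup>2)) (at s)" if "s \<in> {1<..}" for s
        by (rule DERIV_cong[OF DERIV_add[OF DERIV_cmult[OF h] DERIV_const]]) (use that in auto)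
    qed (use that in auto)
    have zt: "z (\<epsilon> * s + t) = - ln r - ln s" if "s > 1" for s
    proof -
      have "\<epsilon> * s + t \<in> I" using that J by blast
      then show ?thesis using r that by (simp add: z vt ln_mult)
    qed
    define b where "b = - (\<epsilon> * \<eta>) * r * (y (\<epsilon> * 2 + t) - \<epsilon> * \<eta> / r * h 2)"
    have one: "\<epsilon> * \<eta> * (\<epsilon> * \<eta>) = 1" using \<epsilon>(1) \<eta> by auto
    have "eq_up_to_constants (generating_curve y z) I (\<lambda>s. vector [0, h s, - ln s]) {1<..}"
    proof (rule eq_up_to_constantsI[OF \<epsilon>(1) _ J, where \<sigma> = "\<epsilon> * \<eta>" and l = "- ln r" and b = b])
      show "\<epsilon> * \<eta> \<in> {1, -1}" using \<epsilon>(1) \<eta> by auto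
      fix s :: real assume "s \<in> {1<..}"
      then have s: "s > 1" by simp
      define C where "C = y (\<epsilon> * 2 + t) - \<epsilon> * \<eta> / r * h 2"
      have "\<epsilon> * \<eta> * exp (- (- ln r)) * y (\<epsilon> * s + t) + b
          = \<epsilon> * \<eta> * r * (\<epsilon> * \<eta> / r * h s + C) - \<epsilon> * \<eta> * r * C"
        using r by (simp add: yt[OF s] b_def C_def)
      also have "\<dots> = (\<epsilon> * \<eta> * (\<epsilon> * \<eta>)) * h s"
        using r by (simp add: field_simps)
      finally show "(vector [0, h s, - ln s] :: real^3) = vector [0, \<epsilon> * \<eta> * exp (- (- ln r)) * y (\<epsilon> * s + t) + b,
          z (\<epsilon> * s + t) - - ln r]"
        using one zt[OF s] by simp
    qed
    then show ?thesis unfolding h_def by blast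
  qed
qed

end

section \<open>Curvature between minus one and zero\<close>

context maximal_profile
begin

text \<open>
If \<open>v\<close> is a single exponential then \<open>y'\<close> is a multiple of \<open>1 / v\<close>, and so is \<open>y\<close> up to a
constant. As \<open>exp z = 1 / v\<close>, the curve is a logarithm.
\<close>

lemma exponential_graph:
  assumes \<rho>: "\<rho> \<noteq> 0" "\<bar>\<rho>\<bar> < 1" and v': "\<And>s. v' s = \<rho> * v s"
  shows "\<exists>b a. a \<noteq> 0 \<and>
    is_graph_of (generating_curve (\<lambda>s. y s + b) z) I (\<lambda>x. ln (a * x)) {x. a * x > 0}"
proof -
  have form: "v s = v 0 * exp (\<rho> * s)" for s
  proof -
    have "v s / exp (\<rho> * s) = v 0"
      by (rule eq_on_open_interval[of UNIV 0 _ "\<lambda>_. v 0" s "\<lambda>_. 0"])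
         (auto intro!: derivative_eq_intros v simp: v')
    then show ?thesis by (simp add: field_simps)
  qed
  obtain s1 where "s1 \<in> I" using I(3) by blast
  then have v0: "v 0 > 0" using vpos[of s1] form[of s1] by (simp add: zero_less_mult_iff)
  then have pos: "v s > 0" for s using form[of s] by simp
  have "\<bar>v' s\<bar> < v s" for s
    using pos[of s] \<rho>(2) by (simp add: v' abs_mult)
  then have UNIV: "I = UNIV" using interval_cone by simp
  define q where "q = sqrt (1 - \<rho>\<^sup>2)"
  have q: "q > 0" using \<rho>(2) by (simp add: q_def abs_square_less_1)
  define a where "a = - \<rho> * \<eta> / q"
  have a0: "a \<noteq> 0" using q \<rho> \<eta> by (auto simp: a_def)
  have ya: "y s = 1 / a * inverse (v s) + (y 0 - 1 / a * inverse (v 0))" for s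
  proof (rule eq_on_open_interval[of UNIV 0 y
        "\<lambda>s. 1 / a * inverse (v s) + (y 0 - 1 / a * inverse (v 0))" s "\<lambda>s. \<eta> * q / v s"])
    show "(y has_real_derivative \<eta> * q / v s) (at s)" for s
    proof -
      have "(v s)\<^sup>2 - (v' s)\<^sup>2 = (v s)\<^sup>2 * (1 - \<rho>\<^sup>2)"
        by (simp add: v' algebra_simps power_mult_distrib)
      then have "sqrt ((v s)\<^sup>2 - (v' s)\<^sup>2) = v s * q"
        using pos[of s] by (simp add: q_def real_sqrt_mult)
      then have "\<eta> * sqrt ((v s)\<^sup>2 - (v' s)\<^sup>2) / (v s)\<^sup>2 = \<eta> * q / v s"
        using pos[of s] by (simp add: power2_eq_square)
      then show ?thesis using y[of s] UNIV by simp
    qed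
    show "((\<lambda>s. 1 / a * inverse (v s) + (y 0 - 1 / a * inverse (v 0))) has_real_derivative \<eta> * q / v s) (at s)" for s
    proof -
      have "1 / a * - (inverse (v s) * v' s * inverse (v s)) + 0 = \<eta> * q / v s"
        using \<eta> q \<rho>(1) pos[of s] by (auto simp: a_def v' field_simps)
      moreover have "v s \<noteq> 0" using pos[of s] by simp
      ultimately show ?thesis
        using DERIV_add[OF DERIV_cmult[OF DERIV_inverse'[OF v(1)]] DERIV_const] by metis
    qed
  qed auto
  define b where "b = - (y 0 - 1 / a * inverse (v 0))"
  have ab: "a * (y s + b) = 1 / v s" for s
    using a0 ya[of s] by (simp add: b_def field_simps)
  have "is_graph_of (generating_curve (\<lambda>s. y s + b) z) I (\<lambda>x. ln (a * x)) {x. a * x > 0}"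
  proof -
    have "(\<lambda>s. y s + b) ` UNIV = {x. a * x > 0}"
    proof
      show "(\<lambda>s. y s + b) ` UNIV \<subseteq> {x. a * x > 0}" using ab pos by auto
      show "{x. a * x > 0} \<subseteq> (\<lambda>s. y s + b) ` UNIV"
      proof
        fix x assume "x \<in> {x. a * x > 0}"
        then have x: "a * x > 0" by simp
        define s where "s = ln (1 / (a * x * v 0)) / \<rho>"
        have "v s = 1 / (a * x)"
          using form[of s] \<rho>(1) x v0 by (simp add: s_def)
        then have "a * (y s + b) = a * x" using ab[of s] by simp
        then show "x \<in> (\<lambda>s. y s + b) ` UNIV" using a0 by auto
      qed
    qed
    then have image: "{x. a * x > 0} = (\<lambda>s. y s + b) ` UNIV" ..
    have "z s = ln (a * (y s + b))" for s
      using z[of s] UNIV pos[of s] by (simp add: ab ln_div)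
    then show ?thesis
      unfolding is_graph_of_def generating_curve_def Setcompr_eq_image UNIV image image_image
        mem_Collect_eq by (simp add: image_image)
  qed
  with a0 show ?thesis by blast
qed

text \<open>
Because \<open>b > 0\<close>, the profile grows at least like \<open>exp (- w s)\<close> towards \<open>s = - \<infinity>\<close>, which is an
end of the domain; hence \<open>z = - ln v\<close> tends to \<open>- \<infinity>\<close> there while \<open>y\<close> stays bounded. If \<open>a > 0\<close> the same
happens at \<open>s = \<infinity>\<close>. If \<open>a < 0\<close> the inequality \<open>\<bar>v'\<bar> < v\<close> fails for large \<open>s\<close>, so the domain is bounded
above and \<open>y\<close> is bounded there too.
\<close>

lemma two_exponentials_graph:
  assumes \<eta>: "\<eta> = 1" and w: "0 < w" "w < 1" and b: "b > 0" and a: "a \<noteq> 0"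
    and form: "\<And>s. v s = (a * exp (w * s) + b * exp (- w * s)) / (2 * w)"
      "\<And>s. v' s = (a * exp (w * s) - b * exp (- w * s)) / 2"
  obtains f m M where "m < M" "graph_curve I y z f m M" "asymptotic_to_line f {m<..<M} m"
    "a > 0 \<Longrightarrow> asymptotic_to_line f {m<..<M} M"
proof -
  have plus: "v s + v' s = (a * (1 + w) * exp (w * s) + b * (1 - w) * exp (- w * s)) / (2 * w)"
    and minus: "v s - v' s = (a * (1 - w) * exp (w * s) + b * (1 + w) * exp (- w * s)) / (2 * w)" for s
    unfolding form using w by (simp_all add: field_simps)
  have cone_iff: "\<bar>v' s\<bar> < v s \<longleftrightarrow> 0 < a * (1 + w) * exp (w * s) + b * (1 - w) * exp (- w * s) \<and>
      0 < a * (1 - w) * exp (w * s) + b * (1 + w) * exp (- w * s)" for s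
  proof -
    have "\<bar>v' s\<bar> < v s \<longleftrightarrow> 0 < v s + v' s \<and> 0 < v s - v' s" by linarith
    then show ?thesis unfolding plus minus using w by (simp add: zero_less_divide_iff)
  qed
  have I_down: "I = {s. \<bar>v' s\<bar> < v s} \<and> (\<forall>s\<in>I. \<forall>r\<le>s. r \<in> I) \<and> (a > 0 \<longrightarrow> I = UNIV)"
  proof (cases "a > 0")
    case True
    then have "\<bar>v' s\<bar> < v s" for s
      unfolding cone_iff using w b by (simp add: add_pos_pos)
    then show ?thesis using interval_cone by auto
  next
    case False
    then have a: "a < 0" using a by simp
    have down: "\<bar>v' r\<bar> < v r" if "\<bar>v' s\<bar> < v s" "r \<le> s" for r s
    proof -
      have "exp (w * r) \<le> exp (w * s)" "exp (- w * s) \<le> exp (- w * r)"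
        using w that(2) by simp_all
      then have "a * (1 + w) * exp (w * s) \<le> a * (1 + w) * exp (w * r)"
        "a * (1 - w) * exp (w * s) \<le> a * (1 - w) * exp (w * r)"
        "b * (1 - w) * exp (- w * s) \<le> b * (1 - w) * exp (- w * r)"
        "b * (1 + w) * exp (- w * s) \<le> b * (1 + w) * exp (- w * r)"
        using a b w by (auto intro!: mult_left_mono mult_left_mono_neg mult_nonpos_nonneg)
      then show ?thesis using that(1) unfolding cone_iff by linarith
    qed
    then have "is_interval {s. \<bar>v' s\<bar> < v s}" unfolding is_interval_1 by blast
    then show ?thesis using interval_cone down a by auto
  qed
  then have down: "r \<in> I" if "s \<in> I" "r \<le> s" for r s using that by blast
  have UNIV: "I = UNIV" if "a > 0" using I_down that by blast
  obtain s1 where s1: "s1 \<in> I" using I(3) by blast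
  \<comment> \<open>From \<open>v + v' > 0\<close> one gets \<open>v > b exp (- w s) / (1 + w)\<close>, also when \<open>a < 0\<close>; half of that constant is enough.\<close>
  define \<kappa> where "\<kappa> = b / (1 + w) / 2"
  have \<kappa>: "\<kappa> > 0" using b w by (simp add: \<kappa>_def)
  have lower: "\<kappa> * exp (- w * s) \<le> v s" if "s \<in> I" for s
  proof -
    have "0 < a * (1 + w) * exp (w * s) + b * (1 - w) * exp (- w * s)"
      using cone[OF that] cone_iff by blast
    also have "\<dots> = (1 + w) * (a * exp (w * s) + b * exp (- w * s)) - 2 * w * (b * exp (- w * s))"
      by (simp add: algebra_simps)
    also have "a * exp (w * s) + b * exp (- w * s) = 2 * w * v s"
      unfolding form using w by simp
    finally have "0 < (1 + w) * (2 * w * v s) - 2 * w * (b * exp (- w * s))" .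
    then have "0 < 2 * w * ((1 + w) * v s - b * exp (- w * s))"
      by (simp add: algebra_simps)
    then have "b * exp (- w * s) < (1 + w) * v s"
      using w by (simp add: zero_less_mult_iff)
    then have "b * exp (- w * s) / (1 + w) < v s" using w by (simp add: field_simps)
    moreover have "\<kappa> * exp (- w * s) \<le> b * exp (- w * s) / (1 + w)"
      using b w by (simp add: \<kappa>_def field_simps)
    ultimately show ?thesis by linarith
  qed
  \<comment> \<open>The double minus matches \<open>y_increment\<close> with the rate \<open>- w\<close>.\<close>
  have lower': "a / (2 * w) * exp (- (- w) * s) \<le> v s" for s
    unfolding form using b w by (simp add: field_simps)
  have bound_below: "y s1 - exp (w * s1) / (\<kappa> * w) \<le> y s" if "s \<in> I" "s \<le> s1" for s
  proof -
    have "y s1 - y s \<le> (exp (w * s1) - exp (w * s)) / (\<kappa> * w)"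
      by (rule y_increment[OF \<eta> that(1) s1 that(2) \<kappa> _ lower]) (use w in auto)
    also have "\<dots> \<le> exp (w * s1) / (\<kappa> * w)"
      using \<kappa> w by (intro divide_right_mono) auto
    finally show ?thesis by linarith
  qed
  have "\<exists>K. \<forall>s\<in>I. s1 \<le> s \<longrightarrow> y s \<le> K"
  proof (cases "a > 0")
    case True
    have "y s \<le> y s1 + exp (- w * s1) / (a / (2 * w) * w)" if "s \<in> I" "s1 \<le> s" for s
    proof -
      have "y s - y s1 \<le> (exp (- w * s) - exp (- w * s1)) / (a / (2 * w) * - w)"
        by (rule y_increment[OF \<eta> s1 that _ _ lower']) (use w True in auto)
      also have "\<dots> = (exp (- w * s1) - exp (- w * s)) / (a / (2 * w) * w)"
        by (simp add: divide_simps)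
      also have "\<dots> \<le> exp (- w * s1) / (a / (2 * w) * w)"
        using True w by (intro divide_right_mono) auto
      finally show ?thesis by linarith
    qed
    then show ?thesis by blast
  next
    case False
    then have a: "a < 0" using a by simp
    \<comment> \<open>The condition \<open>v + v' > 0\<close> reads \<open>exp (w s)\<^sup>2 < D\<close>.\<close>
    define D where "D = b * (1 - w) / (- a * (1 + w))"
    have expD: "exp (w * s) \<le> D + 1" if "s \<in> I" for s
    proof -
      define X where "X = exp (w * s)"
      have X: "X > 0" "exp (- w * s) = 1 / X" by (simp_all add: X_def exp_minus inverse_eq_divide)
      have "0 < a * (1 + w) * X + b * (1 - w) * (1 / X)"
        using cone[OF that] cone_iff X by (simp add: X_def)
      then have "0 < (a * (1 + w) * X + b * (1 - w) * (1 / X)) * X" using X by simp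
      also have "\<dots> = a * (1 + w) * X\<^sup>2 + b * (1 - w)"
        using X by (simp add: field_simps power2_eq_square)
      finally have "X\<^sup>2 * (- a * (1 + w)) < b * (1 - w)" by (simp add: algebra_simps)
      moreover have pos: "0 < - a * (1 + w)" using a w by (intro mult_pos_pos) auto
      ultimately have "X\<^sup>2 < D"
        unfolding D_def pos_less_divide_eq[OF pos] by simp
      moreover have "X \<le> X\<^sup>2 + 1"
        using zero_le_power2[of "X - 1/2"] by (simp add: power2_eq_square algebra_simps)
      ultimately show ?thesis by (simp add: X_def)
    qed
    have "y s \<le> y s1 + (D + 1) / (\<kappa> * w)" if "s \<in> I" "s1 \<le> s" for s
    proof -
      have "y s - y s1 \<le> (exp (w * s) - exp (w * s1)) / (\<kappa> * w)"
        by (rule y_increment[OF \<eta> s1 that \<kappa> _ lower]) (use w in auto)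
      also have "\<dots> \<le> (D + 1) / (\<kappa> * w)"
        using \<kappa> w expD[OF that(1)] by (intro divide_right_mono) (auto intro: order_trans[rotated])
      finally show ?thesis by linarith
    qed
    then show ?thesis by blast
  qed
  then obtain K where K: "\<And>s. s \<in> I \<Longrightarrow> s1 \<le> s \<Longrightarrow> y s \<le> K" by blast
  define L where "L = y s1 - exp (w * s1) / (\<kappa> * w)"
  have "L \<le> y s1" using \<kappa> w by (simp add: L_def)
  have "L \<le> y s \<and> y s \<le> max K (y s1)" if "s \<in> I" for s
  proof (cases s s1 rule: linorder_cases)
    case less
    then show ?thesis using bound_below[OF that] y_increasing[OF \<eta> that s1 less] by (auto simp: L_def)
  next
    case equal
    then show ?thesis using \<open>L \<le> y s1\<close> by simp
  next
    case greater
    then show ?thesis using K[OF that] y_increasing[OF \<eta> s1 that greater] \<open>L \<le> y s1\<close> by auto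
  qed
  then have "y ` I \<subseteq> {L..max K (y s1)}" by auto
  then have "bounded (y ` I)" using bounded_closed_interval bounded_subset by blast
  then obtain f m M where mM: "m < M" and G: "graph_curve I y z f m M"
    using graph_curve_exists[OF \<eta>] by blast
  interpret graph_curve I y z f m M by fact
  have far: "R \<le> \<bar>z s\<bar>" if "s \<in> I" "\<nu> > 0" "\<nu> * exp x \<le> v s" "x \<ge> R - ln \<nu>" for R s x \<nu>
  proof -
    have "R \<le> ln (\<nu> * exp x)" using that(2,4) by (simp add: ln_mult)
    also have "\<dots> \<le> ln (v s)" using that(2,3) vpos[OF that(1)] by (intro ln_mono) auto
    finally show ?thesis using z[OF that(1)] by simp
  qed
  have "asymptotic_to_line f {m<..<M} m"
  proof (rule asymptotic_left)
    fix R
    define t where "t = min s1 ((ln \<kappa> - R) / w)"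
    have "R \<le> \<bar>z s\<bar>" if "s \<in> I" "s < t" for s
    proof (rule far[OF that(1) \<kappa> lower[OF that(1)]])
      have "s \<le> (ln \<kappa> - R) / w" using that(2) by (simp add: t_def)
      then show "R - ln \<kappa> \<le> - w * s" using w by (simp add: field_simps)
    qed
    moreover have "t \<in> I" using down[OF s1] by (simp add: t_def)
    ultimately show "\<exists>t\<in>I. \<forall>s\<in>I. s < t \<longrightarrow> R \<le> \<bar>z s\<bar>" by blast
  qed
  moreover have "asymptotic_to_line f {m<..<M} M" if "a > 0"
  proof (rule asymptotic_right)
    fix R
    define \<nu> where "\<nu> = a / (2 * w)"
    have \<nu>: "\<nu> > 0" using that w by (simp add: \<nu>_def)
    have "R \<le> \<bar>z s\<bar>" if "s \<in> I" "(R - ln \<nu>) / w < s" for s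
    proof (rule far[OF that(1) \<nu> lower'[folded \<nu>_def]])
      show "R - ln \<nu> \<le> - (- w) * s" using w that(2) by (simp add: field_simps)
    qed
    then show "\<exists>t\<in>I. \<forall>s\<in>I. t < s \<longrightarrow> R \<le> \<bar>z s\<bar>" using UNIV[OF that] by blast
  qed
  ultimately show thesis using that mM G by blast
qed

text \<open>
The coefficients of \<open>exp (w s)\<close> and \<open>exp (- w s)\<close> in \<open>v\<close> cannot both be nonpositive. Reversing
the parameter makes the second one, \<open>b\<close>, positive. The sign of the first one, \<open>a\<close>, then decides
between the logarithm (\<open>a = 0\<close>), one vertical asymptote (\<open>a < 0\<close>), and two (\<open>a > 0\<close>).
\<close>

lemma curvature_in_between_case:
  assumes w: "0 < w" "w < 1" and k: "k = w\<^sup>2"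
  shows "\<exists>\<beta> J. eq_up_to_constants (generating_curve y z) I \<beta> J \<and>
          ((\<exists>a. a \<noteq> 0 \<and> is_graph_of \<beta> J (\<lambda>y. ln (a * y)) {y. a * y > 0})
         \<or> (\<exists>f M. 0 < M \<and> is_graph_of \<beta> J f {-M<..<M} \<and>
              asymptotic_to_line f {-M<..<M} (-M) \<and> asymptotic_to_line f {-M<..<M} M)
         \<or> (\<exists>f m M. m < M \<and> is_graph_of \<beta> J f {m<..<M} \<and>
              asymptotic_to_line f {m<..<M} m))"
proof -
  obtain a b where ab: "\<And>s. v s = (a * exp (w * s) + b * exp (- w * s)) / (2 * w)"
    "\<And>s. v' s = (a * exp (w * s) - b * exp (- w * s)) / 2"
    using exponential_form[OF w(1) k] by blast
  obtain s1 where s1: "s1 \<in> I" using I(3) by blast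
  have "a > 0 \<or> b > 0"
  proof (rule ccontr)
    assume "\<not> ?thesis"
    then have "a * exp (w * s1) + b * exp (- w * s1) \<le> 0"
      by (intro add_nonpos_nonpos mult_nonpos_nonneg) auto
    then have "v s1 \<le> 0" unfolding ab using w by (simp add: divide_le_0_iff)
    then show False using vpos[OF s1] by simp
  qed
  then have "\<exists>\<epsilon>\<in>{1, -1}. \<exists>a b. b > 0 \<and>
      (\<forall>s. v (\<epsilon> * s) = (a * exp (w * s) + b * exp (- w * s)) / (2 * w)) \<and>
      (\<forall>s. \<epsilon> * v' (\<epsilon> * s) = (a * exp (w * s) - b * exp (- w * s)) / 2)"
  proof
    assume "a > 0"
    then show ?thesis
      by (intro bexI[of _ "-1"] exI[of _ b] exI[of _ a]) (auto simp: ab algebra_simps)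
  next
    assume "b > 0"
    then show ?thesis
      by (intro bexI[of _ 1] exI[of _ a] exI[of _ b]) (auto simp: ab)
  qed
  then obtain \<epsilon> a b where \<epsilon>: "\<epsilon> \<in> {1, -1}" and b: "b > 0"
    and form: "\<And>s. v (\<epsilon> * s) = (a * exp (w * s) + b * exp (- w * s)) / (2 * w)"
      "\<And>s. \<epsilon> * v' (\<epsilon> * s) = (a * exp (w * s) - b * exp (- w * s)) / 2"
    by blast
  define \<sigma> where "\<sigma> = \<epsilon> * \<eta>"
  have \<sigma>: "\<sigma> \<in> {1, -1}" "\<sigma> * \<epsilon> * \<eta> = 1" using \<epsilon> \<eta> by (auto simp: \<sigma>_def)
  define J where "J = {s. \<epsilon> * s \<in> I}"
  define Y where "Y b0 s = \<sigma> * y (\<epsilon> * s) + b0" for b0 s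
  define Z where "Z s = z (\<epsilon> * s)" for s
  have P: "maximal_profile k J (Y b0) Z (\<lambda>s. v (\<epsilon> * s)) (\<lambda>s. \<epsilon> * v' (\<epsilon> * s)) 1" for b0
    using transform[OF \<epsilon> \<sigma>(1), of b0] unfolding \<sigma>(2) J_def Y_def[abs_def] Z_def[abs_def] .
  have eq: "eq_up_to_constants (generating_curve y z) I (generating_curve (Y b0) Z) J" for b0
    by (rule eq_up_to_constantsI[OF \<epsilon> \<sigma>(1), where t = 0 and l = 0 and b = b0])
       (auto simp: J_def generating_curve_def Y_def Z_def)
  show ?thesis
  proof (cases "a = 0")
    case True
    have "\<epsilon> * v' (\<epsilon> * s) = - w * v (\<epsilon> * s)" for s
      unfolding form True using w by simp
    then obtain b0 a' where a': "a' \<noteq> 0"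
      "is_graph_of (generating_curve (\<lambda>s. Y 0 s + b0) Z) J (\<lambda>x. ln (a' * x)) {x. a' * x > 0}"
      using maximal_profile.exponential_graph[OF P, of "- w" 0] w by auto
    have "(\<lambda>s. Y 0 s + b0) = Y b0" by (simp add: Y_def fun_eq_iff)
    with a' eq show ?thesis by metis
  next
    case False
    have G: "\<exists>f m M. m < M \<and> graph_curve J (Y b0) Z f m M \<and> asymptotic_to_line f {m<..<M} m \<and>
        (a > 0 \<longrightarrow> asymptotic_to_line f {m<..<M} M)" for b0
      by (rule maximal_profile.two_exponentials_graph[OF P refl w b False form]) blast
    then obtain f m M where mM: "m < M" and g: "graph_curve J (Y 0) Z f m M"
      and as: "asymptotic_to_line f {m<..<M} m"
      by blast
    show ?thesis
    proof (cases "a > 0")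
      case False
      show ?thesis using eq mM graph_curve.is_graph[OF g] as by blast
    next
      case True
      \<comment> \<open>A translation centres the interval; the graph of the translated curve is obtained anew.\<close>
      define h where "h = (M - m) / 2"
      define b0 where "b0 = - (m + M) / 2"
      obtain f' m' M' where mM': "m' < M'" and g': "graph_curve J (Y b0) Z f' m' M'"
        and as': "asymptotic_to_line f' {m'<..<M'} m'" "asymptotic_to_line f' {m'<..<M'} M'"
        using G[of b0] True by blast
      have "{m'<..<M'} = Y b0 ` J" using graph_curve.image[OF g'] by simp
      also have "\<dots> = (\<lambda>x. x + b0) ` (Y 0 ` J)" by (auto simp: Y_def image_iff)
      also have "\<dots> = (\<lambda>x. x + b0) ` {m<..<M}" using graph_curve.image[OF g] by simp
      also have "\<dots> = {-h<..<h}"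
      proof
        show "{-h<..<h} \<subseteq> (\<lambda>x. x + b0) ` {m<..<M}"
        proof
          fix x assume "x \<in> {-h<..<h}"
          then have "x - b0 \<in> {m<..<M}" by (auto simp: h_def b0_def field_simps)
          then show "x \<in> (\<lambda>x. x + b0) ` {m<..<M}" by (rule rev_image_eqI) simp
        qed
      qed (auto simp: h_def b0_def field_simps)
      finally have "m' = - h" "M' = h"
        using mM mM' by (auto simp: h_def greaterThanLessThan_eq_iff)
      moreover have "h > 0" using mM by (simp add: h_def)
      ultimately show ?thesis using eq graph_curve.is_graph[OF g'] as' by blast
    qed
  qed
qed

end

section \<open>Positive curvature and curvature below minus one\<close>

context maximal_profile
begin

text \<open>
At a finite end point the inequality \<open>\<bar>v'\<bar> < v\<close> degenerates to an equality, for otherwise the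
domain could be enlarged. It does so with \<open>v > 0\<close>, because \<open>v = v' = 0\<close> at one point forces \<open>v = 0\<close>.
\<close>

lemma endpoint:
  assumes pq: "p < q" "I = {p<..<q}" and e: "e = p \<or> e = q"
  shows "v e > 0 \<and> \<bar>v' e\<bar> = v e"
proof -
  have cont: "continuous_on UNIV v" "continuous_on UNIV v'"
    by (rule continuous_at_imp_continuous_on, blast intro: DERIV_isCont v)+
  have "closed {s. \<bar>v' s\<bar> \<le> v s}"
    by (intro closed_Collect_le continuous_intros cont)
  then have "closure I \<subseteq> {s. \<bar>v' s\<bar> \<le> v s}"
    by (rule closure_minimal[rotated]) (auto dest: cone)
  moreover have "e \<in> closure I" using pq e by auto
  ultimately have le: "\<bar>v' e\<bar> \<le> v e" by blast
  have "\<not> \<bar>v' e\<bar> < v e"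
  proof
    assume lt: "\<bar>v' e\<bar> < v e"
    have "open {s. \<bar>v' s\<bar> < v s}"
      by (intro open_Collect_less continuous_intros cont)
    then obtain d where d: "d > 0" "ball e d \<subseteq> {s. \<bar>v' s\<bar> < v s}"
      using lt open_contains_ball by blast
    have "I \<union> ball e d = I"
    proof (rule maximal)
      have "connected (I \<union> ball e d)"
      proof (rule connected_Un)
        show "I \<inter> ball e d \<noteq> {}"
        proof -
          define x where "x = min d (q - p) / 2"
          have x: "0 < x" "x < d" "x < q - p" using d(1) pq(1) by (auto simp: x_def)
          have "(if e = p then p + x else q - x) \<in> I \<inter> ball e d"
            using x e pq by (auto simp: dist_real_def)
          then show ?thesis by blast
        qed
      qed (use I(2) in \<open>auto simp: is_interval_connected_1\<close>)
      then show "is_interval (I \<union> ball e d)" by (simp add: is_interval_connected_1)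
    qed (use I(1) cone d(2) in auto)
    moreover have "e \<in> ball e d" using d(1) by simp
    ultimately have "e \<in> I" by blast
    then show False using pq e by auto
  qed
  with le have eq: "\<bar>v' e\<bar> = v e" by simp
  have "v e \<noteq> 0"
  proof
    assume ve: "v e = 0"
    then have v'e: "v' e = 0" using eq by simp
    obtain s1 where s1: "s1 \<in> I" using I(3) by blast
    have "v s1 = 0"
      by (rule linear_ode_unique[of UNIV e s1 v v' k "\<lambda>_. 0" "\<lambda>_. 0"])
         (use v ve v'e in \<open>auto intro!: derivative_eq_intros\<close>)
    then show False using vpos[OF s1] by simp
  qed
  with eq show ?thesis by linarith
qed

text \<open>
The sine of the angle function; it is kept as a function on the whole line because its values
at the end points of \<open>I\<close> are needed.
\<close>

definition slope :: "real \<Rightarrow> real" where "slope s = - v' s / v s"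

lemma slope_deriv: "v s \<noteq> 0 \<Longrightarrow> (slope has_real_derivative (slope s)\<^sup>2 - k) (at s)"
  unfolding slope_def[abs_def]
  by (rule derivative_eq_intros v refl)+ (simp_all add: field_simps power2_eq_square)

lemma slope_less_1: "s \<in> I \<Longrightarrow> \<bar>slope s\<bar> < 1"
  using cone[of s] vpos[of s] by (simp add: slope_def abs_divide)

text \<open>
The slope stays in \<open>(-1, 1)\<close>, but its derivative \<open>slope\<^sup>2 - k\<close> has a fixed sign and is bounded away
from zero. Hence only a bounded interval of parameters is possible.
\<close>

lemma bounded_domain:
  assumes "k > 1 \<or> k < 0"
  shows "bounded I"
proof -
  obtain \<delta> \<tau> where \<delta>: "\<delta> > 0" and \<tau>: "\<tau> \<in> {1, -1}"
    and rate: "\<And>s. s \<in> I \<Longrightarrow> \<delta> \<le> \<tau> * ((slope s)\<^sup>2 - k)"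
  proof (cases "k > 1")
    case True
    show thesis
    proof (rule that[of "k - 1" "-1"])
      fix s assume "s \<in> I"
      then have "(slope s)\<^sup>2 < 1" using slope_less_1 by (simp add: abs_square_less_1)
      then show "k - 1 \<le> - 1 * ((slope s)\<^sup>2 - k)" by simp
    qed (use True in auto)
  next
    case False
    then show thesis using assms by (intro that[of "- k" 1]) auto
  qed
  have "t - s \<le> 2 / \<delta>" if st: "s \<in> I" "t \<in> I" "s \<le> t" for s t
  proof -
    have "\<tau> * slope s - \<delta> * s \<le> \<tau> * slope t - \<delta> * t"
    proof (rule DERIV_nonneg_imp_nondecreasing[OF st(3)])
      fix r assume "s \<le> r" "r \<le> t"
      then have r: "r \<in> I" using I(2) st unfolding is_interval_1 by blast
      have "((\<lambda>r. \<tau> * slope r - \<delta> * r) has_real_derivative \<tau> * ((slope r)\<^sup>2 - k) - \<delta>) (at r)"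
        using vpos[OF r] by (auto intro!: derivative_eq_intros slope_deriv)
      with rate[OF r] show "\<exists>D. ((\<lambda>r. \<tau> * slope r - \<delta> * r) has_real_derivative D) (at r) \<and> 0 \<le> D"
        by (intro exI[of _ "\<tau> * ((slope r)\<^sup>2 - k) - \<delta>"]) auto
    qed
    moreover have "\<tau> * slope t \<le> 1" "\<tau> * slope s \<ge> - 1"
      using \<tau> slope_less_1[OF st(1)] slope_less_1[OF st(2)] by auto
    ultimately have "\<delta> * (t - s) \<le> 2" by (simp add: algebra_simps)
    then show ?thesis using \<delta> by (simp add: field_simps)
  qed
  then have "dist s t \<le> 2 / \<delta>" if "s \<in> I" "t \<in> I" for s t
    using that \<delta> by (cases "s \<le> t") (auto simp: dist_real_def abs_if)
  then show ?thesis unfolding bounded_def by (meson I(3) all_not_in_conv)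
qed

lemma cos_angle:
  assumes "s \<in> I"
  shows "sol_cos_angle (generating_curve y z s) (vector_derivative (generating_curve y z) (at s)) (axis 3 1)
    = slope s"
proof -
  define p where "p = \<eta> * sqrt ((v s)\<^sup>2 - (v' s)\<^sup>2) / (v s)\<^sup>2"
  have d: "vector_derivative (generating_curve y z) (at s) = vector [0, p, slope s]"
    unfolding generating_curve_def[abs_def] p_def slope_def
    by (rule vector_derivative_at[OF has_vector_derivative_vector_3[OF DERIV_const y[OF assms]
            z_deriv[OF assms]]])
  have vs: "v s > 0" using vpos[OF assms] .
  have "exp (- 2 * z s) = (v s)\<^sup>2"
    using vs by (simp add: z[OF assms] exp_double)
  moreover have "(v s)\<^sup>2 * p\<^sup>2 + (slope s)\<^sup>2 = 1"
  proof -
    have "(v s)\<^sup>2 \<ge> (v' s)\<^sup>2" using cone[OF assms] power_mono[of "\<bar>v' s\<bar>" "v s" 2] by simp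
    moreover have "\<eta>\<^sup>2 = 1" using \<eta> by auto
    ultimately have "p\<^sup>2 = ((v s)\<^sup>2 - (v' s)\<^sup>2) / ((v s)\<^sup>2)\<^sup>2"
      by (simp add: p_def power_divide power_mult_distrib)
    then have "(v s)\<^sup>2 * p\<^sup>2 = ((v s)\<^sup>2 - (v' s)\<^sup>2) / (v s)\<^sup>2"
      using vs by (simp add: power2_eq_square)
    moreover have "(slope s)\<^sup>2 = (v' s)\<^sup>2 / (v s)\<^sup>2" by (simp add: slope_def power_divide)
    moreover have "((v s)\<^sup>2 - (v' s)\<^sup>2) / (v s)\<^sup>2 + (v' s)\<^sup>2 / (v s)\<^sup>2 = 1"
      using vs by (simp flip: add_divide_distrib)
    ultimately show ?thesis by simp
  qed
  ultimately show ?thesis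
    unfolding sol_cos_angle_def d generating_curve_def sol_metric_vector
    by (simp add: axis_def mult.assoc flip: power2_eq_square)
qed

text \<open>
The slope runs strictly monotonically through all of \<open>[-1, 1]\<close> on the closed interval \<open>[p, q]\<close>.
Its only zero is the only extremum of \<open>z\<close>, a maximum for \<open>k > 1\<close> and a minimum for \<open>k < 0\<close>; the
values \<open>\<plusminus> 1\<close> at the ends mean that the curve becomes vertical there. Since \<open>v\<close> is positive on \<open>[p, q]\<close>,
the curve is bounded.
\<close>

lemma vertical_ends_case:
  assumes \<eta>: "\<eta> = 1" and k: "k > 1 \<or> k < 0"
  shows "\<exists>f a0 b0. a0 < b0 \<and> is_graph_of (generating_curve y z) I f {a0<..<b0} \<and>
    single_max_or_min f {a0<..<b0} \<and> bounded (generating_curve y z ` I) \<and>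
    vertical_towards (generating_curve y z) I a0 \<and> vertical_towards (generating_curve y z) I b0"
proof -
  obtain p q where pq: "p < q" "I = {p<..<q}"
    using bounded_open_interval[OF I(1,2) bounded_domain[OF k] I(3)] by blast
  have vpq: "v s > 0" if "s \<in> {p..q}" for s
    using that endpoint[OF pq] vpos[of s] pq by (cases "s = p \<or> s = q") auto
  have slope1: "\<bar>slope p\<bar> = 1" "\<bar>slope q\<bar> = 1"
    using endpoint[OF pq, of p] endpoint[OF pq, of q] by (auto simp: slope_def abs_divide)
  have slope_pq: "\<bar>slope s\<bar> \<le> 1" if "s \<in> {p..q}" for s
    using that slope1 slope_less_1[of s] pq by (cases "s = p \<or> s = q") auto
  have slope_cont: "isCont slope s" if "s \<in> {p..q}" for s
    using slope_deriv[of s] vpq[OF that] by (auto intro: DERIV_isCont)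
  have cont: "continuous_on {p..q} v"
    by (rule continuous_at_imp_continuous_on) (blast intro: DERIV_isCont v)
  have compact: "compact {p..q}" by simp
  define \<tau> :: real where "\<tau> = (if k > 1 then - 1 else 1)"
  have \<tau>: "\<tau> \<in> {1, -1}" by (simp add: \<tau>_def)
  have rate: "\<tau> * ((slope s)\<^sup>2 - k) > 0" if "s \<in> {p..q}" for s
  proof -
    have "0 \<le> (slope s)\<^sup>2" "(slope s)\<^sup>2 \<le> 1"
      using slope_pq[OF that] by (simp_all add: abs_square_le_1)
    then have "k > 1 \<Longrightarrow> (slope s)\<^sup>2 < k" "k < 0 \<Longrightarrow> k < (slope s)\<^sup>2" by linarith+
    then show ?thesis using k by (auto simp: \<tau>_def)
  qed
  have incr: "\<tau> * slope s < \<tau> * slope t" if "s \<in> {p..q}" "t \<in> {p..q}" "s < t" for s t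
  proof (rule strict_mono_on_interval[OF _ _ rate that])
    show "is_interval {p..q}" by (rule is_interval_cc)
    show "((\<lambda>s. \<tau> * slope s) has_real_derivative \<tau> * ((slope s)\<^sup>2 - k)) (at s)" if "s \<in> {p..q}" for s
      using vpq[OF that] by (intro DERIV_cmult slope_deriv) simp
  qed
  have ends: "\<tau> * slope p = - 1" "\<tau> * slope q = 1"
    using incr[of p q] pq(1) slope1 \<tau> by (auto simp: abs_if split: if_splits)
  obtain s0 where s0: "p \<le> s0" "s0 \<le> q" "\<tau> * slope s0 = 0"
    using IVT[of "\<lambda>s. \<tau> * slope s" p 0 q] ends pq(1) slope_cont by auto
  then have s0I: "s0 \<in> I" using ends pq by (auto simp: less_le)
  have slope_neg: "\<tau> * slope s < 0" if "s \<in> I" "s < s0" for s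
    using incr[of s s0] that s0 pq by auto
  have slope_pos: "\<tau> * slope s > 0" if "s \<in> I" "s0 < s" for s
    using incr[of s0 s] that s0 pq by auto
  have zd: "((\<lambda>s. \<tau> * z s) has_real_derivative \<tau> * slope s) (at s)" if "s \<in> I" for s
    using z_deriv[OF that] unfolding slope_def by (intro DERIV_cmult)
  have z_left: "\<tau> * z t < \<tau> * z s" if "s \<in> I" "s < t" "t \<le> s0" for s t
  proof (rule DERIV_neg_imp_decreasing_open[OF that(2)])
    fix r assume "s < r" "r < t"
    then have "r \<in> I" "r < s0" using that pq s0I by auto
    then show "\<exists>D. ((\<lambda>s. \<tau> * z s) has_real_derivative D) (at r) \<and> D < 0"
      using zd slope_neg by blast
  next
    have "{s..t} \<subseteq> I" using that pq s0I by auto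
    then show "continuous_on {s..t} (\<lambda>s. \<tau> * z s)"
      by (intro continuous_at_imp_continuous_on) (blast intro: DERIV_isCont zd)
  qed
  have z_right: "\<tau> * z s < \<tau> * z t" if "t \<in> I" "s < t" "s0 \<le> s" for s t
  proof (rule DERIV_pos_imp_increasing_open[OF that(2)])
    fix r assume "s < r" "r < t"
    then have "r \<in> I" "s0 < r" using that pq s0I by auto
    then show "\<exists>D. ((\<lambda>s. \<tau> * z s) has_real_derivative D) (at r) \<and> D > 0"
      using zd slope_pos by blast
  next
    have "{s..t} \<subseteq> I" using that pq s0I by auto
    then show "continuous_on {s..t} (\<lambda>s. \<tau> * z s)"
      by (intro continuous_at_imp_continuous_on) (blast intro: DERIV_isCont zd)
  qed
  have "bounded (z ` I)"
  proof -
    have "compact ((\<lambda>s. - ln (v s)) ` {p..q})"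
      using vpq by (intro compact_continuous_image continuous_intros cont compact) force
    then have "bounded ((\<lambda>s. - ln (v s)) ` {p..q})" by (rule compact_imp_bounded)
    moreover have "z ` I \<subseteq> (\<lambda>s. - ln (v s)) ` {p..q}"
      using pq by (auto simp: z intro!: image_eqI)
    ultimately show ?thesis by (rule bounded_subset)
  qed
  have "bounded (y ` I)"
  proof -
    \<comment> \<open>A positive lower bound for \<open>v s * exp s\<close> is one of the form required by \<open>y_increment\<close> with rate \<open>1\<close>.\<close>
    have "continuous_on {p..q} (\<lambda>s. v s * exp s)" by (intro continuous_intros cont)
    then obtain t where t: "t \<in> {p..q}" "\<And>s. s \<in> {p..q} \<Longrightarrow> v t * exp t \<le> v s * exp s"
      using continuous_attains_inf[OF compact, of "\<lambda>s. v s * exp s"] pq(1) by fastforce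
    define \<kappa> where "\<kappa> = v t * exp t"
    have \<kappa>: "\<kappa> > 0" using vpq[OF t(1)] by (simp add: \<kappa>_def)
    have lower: "\<kappa> * exp (- 1 * s) \<le> v s" if "s \<in> I" for s
      using t(2)[of s] that pq by (simp add: \<kappa>_def exp_minus field_simps)
    have inc: "y t - y s \<le> exp q / \<kappa>" if "s \<in> I" "t \<in> I" "s \<le> t" for s t
    proof -
      have "y t - y s \<le> (exp (1 * t) - exp (1 * s)) / (\<kappa> * 1)"
        by (rule y_increment[OF \<eta> that \<kappa> _ lower]) auto
      moreover have "exp t \<le> exp q" "0 < exp s" using that pq by auto
      then have "(exp t - exp s) / \<kappa> \<le> exp q / \<kappa>"
        using \<kappa> by (intro divide_right_mono) linarith+
      ultimately show ?thesis by simp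
    qed
    have "dist (y s) (y t) \<le> exp q / \<kappa>" if "s \<in> I" "t \<in> I" "s < t" for s t
      using inc[of s t] y_increasing[OF \<eta> that] that by (simp add: dist_real_def)
    then have "dist (y s0) (y t) \<le> exp q / \<kappa>" if "t \<in> I" "t \<noteq> s0" for t
      using s0I that by (metis dist_commute linorder_neqE_linordered_idom)
    then have "dist (y s0) (y t) \<le> exp q / \<kappa>" if "t \<in> I" for t
      using that \<kappa> by (cases "t = s0") auto
    then show ?thesis unfolding bounded_def by auto
  qed
  then obtain f m M where mM: "m < M" and G: "graph_curve I y z f m M"
    using graph_curve_exists[OF \<eta>] by blast
  interpret graph_curve I y z f m M by fact
  have "single_max_or_min f {m<..<M}"
  proof (rule single_max_or_minI[OF \<tau>])
    show "y s0 \<in> {m<..<M}" using s0I image by blast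
    show "\<tau> * f x' < \<tau> * f x" if x: "m < x" "x < x'" "x' \<le> y s0" for x x'
    proof -
      have "y s0 < M" using s0I image by auto
      then obtain s t where st: "s \<in> I" "x = y s" "t \<in> I" "x' = y t"
        using x preimage[of x] preimage[of x'] by force
      then have "s < t" "t \<le> s0" using x less_iff[of s t] less_iff[of s0 t] s0I by auto
      then show ?thesis using z_left[OF st(1)] st graph by simp
    qed
    show "\<tau> * f x < \<tau> * f x'" if x: "y s0 \<le> x" "x < x'" "x' < M" for x x'
    proof -
      have "m < y s0" using s0I image by auto
      then obtain s t where st: "s \<in> I" "x = y s" "t \<in> I" "x' = y t"
        using x preimage[of x] preimage[of x'] by force
      then have "s < t" "s0 \<le> s" using x less_iff[of s t] less_iff[of s s0] s0I by auto
      then show ?thesis using z_right[OF st(3)] st graph by simp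
    qed
  qed
  moreover have "bounded (generating_curve y z ` I)"
  proof -
    obtain A B where AB: "\<And>s. s \<in> I \<Longrightarrow> \<bar>y s\<bar> \<le> A" "\<And>s. s \<in> I \<Longrightarrow> \<bar>z s\<bar> \<le> B"
      using \<open>bounded (y ` I)\<close> \<open>bounded (z ` I)\<close> unfolding bounded_iff by auto
    have "norm (generating_curve y z s) \<le> A + B" if "s \<in> I" for s
      using norm_le_l1_cart[of "generating_curve y z s"] AB[OF that]
      by (simp add: generating_curve_def sum_3)
    then show ?thesis unfolding bounded_iff by blast
  qed
  moreover have near: "\<exists>t\<in>I. \<forall>s\<in>I. (if e = p then s < t else t < s) \<longrightarrow>
      dist \<bar>sol_cos_angle (generating_curve y z s) (vector_derivative (generating_curve y z) (at s)) (axis 3 1)\<bar> 1 < d"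
    if "d > 0" "e \<in> {p, q}" for d e
  proof -
    have "isCont (\<lambda>s. \<bar>slope s\<bar>) e"
      using slope_cont[of e] that(2) pq(1) by (auto intro!: continuous_intros)
    then have "\<exists>\<delta>>0. \<forall>s. dist s e < \<delta> \<longrightarrow> dist \<bar>slope s\<bar> \<bar>slope e\<bar> < d"
      unfolding continuous_at_eps_delta using that(1) by (simp add: dist_commute)
    then obtain \<delta> where \<delta>: "\<delta> > 0" "\<And>s. dist s e < \<delta> \<Longrightarrow> dist \<bar>slope s\<bar> \<bar>slope e\<bar> < d"
      by blast
    define x where "x = min \<delta> (q - p) / 2"
    have x: "0 < x" "x < \<delta>" "x < q - p" using \<delta>(1) pq(1) by (auto simp: x_def)
    define t where "t = (if e = p then p + x else q - x)"
    have "t \<in> I" using x pq by (auto simp: t_def)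
    moreover have "dist \<bar>slope s\<bar> 1 < d" if s: "s \<in> I" "if e = p then s < t else t < s" for s
    proof -
      have "dist s e < \<delta>"
        using s x \<open>e \<in> {p, q}\<close> pq by (auto simp: dist_real_def t_def split: if_splits)
      then show ?thesis using \<delta>(2) slope1 \<open>e \<in> {p, q}\<close> by fastforce
    qed
    ultimately show ?thesis by (intro bexI[of _ t]) (simp_all add: cos_angle)
  qed
  moreover have gen2: "(\<lambda>s. generating_curve y z s $ 2) = y" by (simp add: generating_curve_def)
  moreover have "vertical_towards (generating_curve y z) I m"
    unfolding vertical_towards_def gen2 by (rule limit_left) (use near[of _ p] in simp)
  moreover have "vertical_towards (generating_curve y z) I M"
    unfolding vertical_towards_def gen2 by (rule limit_right) (use near[of _ q] pq(1) in simp)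
  ultimately show ?thesis using mM is_graph by blast
qed

end

section \<open>Vertical curves of curvature zero\<close>

text \<open>
With \<open>cos \<theta> = 0\<close> everywhere the angle is constant, so the curve is part of a vertical line
\<open>y = const\<close>. The full line is a solution too, so maximality makes the curve equal to it.
\<close>

lemma vertical_leaf:
  assumes max: "maximal_const_Kext_solution 0 I y z \<theta>"
    and vertical: "\<And>s. s \<in> I \<Longrightarrow> cos (\<theta> s) = 0"
  shows "invariant_surface I y z \<in> foliation2"
proof -
  have cs: "const_Kext_solution 0 I y z \<theta>"
    using max by (simp add: maximal_const_Kext_solution_def)
  note sol = const_Kext_solutionD[OF cs]
  obtain s0 where s0: "s0 \<in> I" using sol(3) by blast
  have deriv_\<theta>: "deriv \<theta> s = 0" if s: "s \<in> I" for s
  proof -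
    have "((\<lambda>s. cos (\<theta> s)) has_real_derivative 0) (at s)"
      by (rule has_field_derivative_transform_within_open[OF DERIV_const[of 0] sol(1) s]) (simp add: vertical)
    moreover have "((\<lambda>s. cos (\<theta> s)) has_real_derivative - sin (\<theta> s) * deriv \<theta> s) (at s)"
      using sol(6)[OF s] by (auto intro!: derivative_eq_intros)
    ultimately have "- sin (\<theta> s) * deriv \<theta> s = 0" by (rule DERIV_unique[rotated])
    moreover have "sin (\<theta> s) \<noteq> 0" using vertical[OF s] sin_zero_abs_cos_one by fastforce
    ultimately show ?thesis by simp
  qed
  have \<theta>0: "(\<theta> has_real_derivative 0) (at s)" and y0: "(y has_real_derivative 0) (at s)" if "s \<in> I" for s
    using sol(4,6)[OF that] deriv_\<theta>[OF that] vertical[OF that] by simp_all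
  have \<theta>: "\<theta> s = \<theta> s0" if "s \<in> I" for s
    by (rule eq_on_open_interval[OF sol(1,2) s0 _ that, where g = "\<lambda>_. \<theta> s0" and d = "\<lambda>_. 0"])
       (simp_all add: \<theta>0)
  have y: "y s = y s0" if "s \<in> I" for s
    by (rule eq_on_open_interval[OF sol(1,2) s0 _ that, where g = "\<lambda>_. y s0" and d = "\<lambda>_. 0"])
       (simp_all add: y0)
  define u where "u = sin (\<theta> s0)"
  define a where "a = z s0 - u * s0"
  have z: "z s = u * s + a" if "s \<in> I" for s
  proof (rule eq_on_open_interval[OF sol(1,2) s0 _ that, where g = "\<lambda>s. u * s + a" and d = "\<lambda>_. u"])
    show "(z has_real_derivative u) (at s)" if "s \<in> I" for s
      using sol(5)[OF that] by (simp add: \<theta>[OF that] u_def)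
    show "((\<lambda>s. u * s + a) has_real_derivative u) (at s)" for s
      by (auto intro!: derivative_eq_intros)
  qed (simp add: a_def)
  have u0: "u \<noteq> 0" using vertical[OF s0] sin_zero_abs_cos_one by (fastforce simp: u_def)
  have "const_Kext_solution 0 UNIV (\<lambda>_. y s0) (\<lambda>s. u * s + a) (\<lambda>_. \<theta> s0)"
  proof -
    define P :: "(real \<Rightarrow> real) set" where "P = {(\<lambda>s. m * s + n) |m n. True}"
    have smooth: "smooth_on_reals UNIV (\<lambda>s. m * s + n)" for m n :: real
    proof (rule smooth_on_reals_closed_class)
      show "(\<lambda>s. m * s + n) \<in> P" by (auto simp: P_def)
      fix f assume "f \<in> P"
      then obtain m n where f: "f = (\<lambda>s. m * s + n)" by (auto simp: P_def)
      have "(\<lambda>s. 0 * s + m) \<in> P" unfolding P_def by blast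
      moreover have "(f has_real_derivative 0 * s + m) (at s)" for s
        unfolding f by (auto intro!: derivative_eq_intros)
      ultimately show "\<exists>g\<in>P. \<forall>s\<in>UNIV. (f has_real_derivative g s) (at s)"
        by (intro bexI[of _ "\<lambda>s. 0 * s + m"]) auto
    qed simp
    have zd: "((\<lambda>s. u * s + a) has_real_derivative sin (\<theta> s0)) (at s)" for s
      by (auto intro!: derivative_eq_intros simp: u_def)
    have "sol_extrinsic_curvature (invariant_param (\<lambda>_. y s0) (\<lambda>s. u * s + a)) s t
        = - cos (\<theta> s0) * (0 + cos (\<theta> s0))" for s t
      by (rule extrinsic_curvature_invariant_param[of UNIV s _ _ "\<lambda>_. \<theta> s0"])
         (use zd vertical[OF s0] in auto)
    then show ?thesis
      unfolding const_Kext_solution_def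
      using smooth[of 0] smooth zd vertical[OF s0] by auto
  qed
  moreover have "\<forall>s\<in>I. y s0 = y s \<and> u * s + a = z s \<and> \<theta> s0 = \<theta> s"
    using y[symmetric] z[symmetric] \<theta>[symmetric] by blast
  ultimately have UNIV: "I = UNIV"
    using max[unfolded maximal_const_Kext_solution_def, THEN conjunct2, THEN spec[of _ UNIV],
        THEN spec[of _ "\<lambda>_. y s0"], THEN spec[of _ "\<lambda>s. u * s + a"], THEN spec[of _ "\<lambda>_. \<theta> s0"]]
    by simp
  have "invariant_param y z s x = vector [x, y s0, u * s + a]" for s x
    using y[of s] z[of s] UNIV by (simp add: invariant_param_def)
  then have "invariant_surface I y z = {vector [x, y s0, u * s + a] |s x. True}"
    by (simp add: invariant_surface_def UNIV)
  also have "\<dots> = {vector [x, y s0, w] |x w. True}"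
  proof (intro Collect_cong iffI)
    fix p :: "real^3"
    assume "\<exists>x w. p = vector [x, y s0, w] \<and> True"
    then obtain x w where "p = vector [x, y s0, w]" by blast
    moreover have "u * ((w - a) / u) + a = w" using u0 by simp
    ultimately show "\<exists>s x. p = vector [x, y s0, u * s + a] \<and> True" by metis
  qed blast
  finally show ?thesis unfolding foliation2_def by blast
qed

text \<open>
For \<open>c = 0\<close> the condition \<open>cos \<theta> = 0\<close> holds everywhere or nowhere: the conserved quantity is
\<open>v\<^sup>2 - v'\<^sup>2\<close> for \<open>v = exp (- z)\<close>.
\<close>

lemma flat_first_integral:
  assumes "const_Kext_solution 0 I y z \<theta>" "s1 \<in> I" "s \<in> I"
  shows "(cos (\<theta> s) * exp (- z s))\<^sup>2 = (cos (\<theta> s1) * exp (- z s1))\<^sup>2"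
proof -
  note sol = const_Kext_solutionD[OF assms(1)]
  show ?thesis
  proof (rule eq_on_open_interval[OF sol(1,2) assms(2) _ assms(3),
        where g = "\<lambda>_. (cos (\<theta> s1) * exp (- z s1))\<^sup>2" and d = "\<lambda>_. 0"])
    fix s assume s: "s \<in> I"
    have "((\<lambda>s. (cos (\<theta> s) * exp (- z s))\<^sup>2) has_real_derivative
        2 * (exp (- z s))\<^sup>2 * sin (\<theta> s) * (- cos (\<theta> s) * (deriv \<theta> s + cos (\<theta> s)))) (at s)"
      by (rule derivative_eq_intros sol(5,6)[OF s] refl)+
         (simp add: algebra_simps power2_eq_square)
    then show "((\<lambda>s. (cos (\<theta> s) * exp (- z s))\<^sup>2) has_real_derivative 0) (at s)"
      unfolding sol(7)[OF s] by simp
  qed simp_all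
qed

section \<open>The classification\<close>

theorem theorem4p3:
  fixes c :: real and I :: "real set" and y z \<theta> :: "real \<Rightarrow> real"
    and \<alpha> :: "real \<Rightarrow> real^3" and S :: "(real^3) set"
  assumes "maximal_const_Kext_solution c I y z \<theta>"
    and "\<alpha> = generating_curve y z"
    and "S = invariant_surface I y z"
  shows
    "(c = 0 \<longrightarrow>
        S \<in> foliation2 \<or>
        eq_up_to_constants \<alpha> I (\<lambda>s. vector [0, tanh s, - ln (cosh s)]) UNIV)
   \<and> (c = -1 \<longrightarrow>
        S \<in> foliation3 \<or>
        eq_up_to_constants \<alpha> I
          (\<lambda>s. vector [0, - (sqrt (s\<^sup>2 - 1) / s) + ln (s + sqrt (s\<^sup>2 - 1)), - ln s]) {1<..})
   \<and> (-1 < c \<and> c < 0 \<longrightarrow>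
        (\<exists>\<beta> J. eq_up_to_constants \<alpha> I \<beta> J \<and>
          ((\<exists>a. a \<noteq> 0 \<and> is_graph_of \<beta> J (\<lambda>y. ln (a * y)) {y. a * y > 0})
         \<or> (\<exists>f M. 0 < M \<and> is_graph_of \<beta> J f {-M<..<M} \<and>
              asymptotic_to_line f {-M<..<M} (-M) \<and> asymptotic_to_line f {-M<..<M} M)
         \<or> (\<exists>f m M. m < M \<and> is_graph_of \<beta> J f {m<..<M} \<and>
              asymptotic_to_line f {m<..<M} m))))
   \<and> (c > 0 \<or> c < -1 \<longrightarrow>
        (\<exists>\<beta> J. eq_up_to_constants \<alpha> I \<beta> J \<and>
          (\<exists>f a0 b0. a0 < b0 \<and> is_graph_of \<beta> J f {a0<..<b0} \<and>
             single_max_or_min f {a0<..<b0} \<and> bounded (\<beta> ` J) \<and>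
             vertical_towards \<beta> J a0 \<and> vertical_towards \<beta> J b0)))"
proof -
  have cs: "const_Kext_solution c I y z \<theta>"
    using assms(1) by (simp add: maximal_const_Kext_solution_def)
  note sol = const_Kext_solutionD[OF cs]
  have profile: "\<exists>v v' \<eta>. maximal_profile (1 + c) I y z v v' \<eta>" if "\<And>s. s \<in> I \<Longrightarrow> cos (\<theta> s) \<noteq> 0"
    using maximal_profile_exists[OF assms(1) that] by blast
  have nz: "cos (\<theta> s) \<noteq> 0" if "c \<noteq> 0" "s \<in> I" for s
    using sol(7)[OF that(2)] that(1) by auto
  show ?thesis
  proof (intro conjI impI)
    assume c: "c = 0"
    show "S \<in> foliation2 \<or> eq_up_to_constants \<alpha> I (\<lambda>s. vector [0, tanh s, - ln (cosh s)]) UNIV"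
    proof (cases "\<exists>s1\<in>I. cos (\<theta> s1) \<noteq> 0")
      case False
      then show ?thesis using vertical_leaf[of I y z \<theta>] assms c by auto
    next
      case True
      then obtain s1 where s1: "s1 \<in> I" "cos (\<theta> s1) \<noteq> 0" by blast
      have "cos (\<theta> s) \<noteq> 0" if "s \<in> I" for s
        using flat_first_integral[OF cs[unfolded c] s1(1) that] s1(2) by auto
      then obtain v v' \<eta> where "maximal_profile (1 + c) I y z v v' \<eta>" using profile by blast
      then have "maximal_profile 1 I y z v v' \<eta>" by (simp add: c)
      from maximal_profile.zero_curvature_case[OF this refl] show ?thesis by (simp add: assms(2))
    qed
  next
    assume c: "c = - 1"
    then obtain v v' \<eta> where "maximal_profile (1 + c) I y z v v' \<eta>" using profile nz by force
    then have "maximal_profile 0 I y z v v' \<eta>" by (simp add: c)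
    from maximal_profile.curvature_minus_one_case[OF this refl]
    show "S \<in> foliation3 \<or> eq_up_to_constants \<alpha> I
        (\<lambda>s. vector [0, - (sqrt (s\<^sup>2 - 1) / s) + ln (s + sqrt (s\<^sup>2 - 1)), - ln s]) {1<..}"
      unfolding assms(2,3) .
  next
    assume c: "- 1 < c \<and> c < 0"
    then obtain v v' \<eta> where "maximal_profile (1 + c) I y z v v' \<eta>" using profile nz by force
    moreover have "sqrt (1 + c) < 1" "0 < sqrt (1 + c)" "1 + c = (sqrt (1 + c))\<^sup>2"
      using c by simp_all
    ultimately show "\<exists>\<beta> J. eq_up_to_constants \<alpha> I \<beta> J \<and>
          ((\<exists>a. a \<noteq> 0 \<and> is_graph_of \<beta> J (\<lambda>y. ln (a * y)) {y. a * y > 0})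
         \<or> (\<exists>f M. 0 < M \<and> is_graph_of \<beta> J f {-M<..<M} \<and>
              asymptotic_to_line f {-M<..<M} (-M) \<and> asymptotic_to_line f {-M<..<M} M)
         \<or> (\<exists>f m M. m < M \<and> is_graph_of \<beta> J f {m<..<M} \<and>
              asymptotic_to_line f {m<..<M} m))"
      unfolding assms(2) by (intro maximal_profile.curvature_in_between_case)
  next
    assume c: "c > 0 \<or> c < - 1"
    then obtain v v' \<eta> where p: "maximal_profile (1 + c) I y z v v' \<eta>" using profile nz by force
    have \<eta>: "\<eta> \<in> {1, -1}" "\<eta> * 1 * \<eta> = 1" using maximal_profile.\<eta>[OF p] by auto
    define Y where "Y s = \<eta> * y s" for s
    have "maximal_profile (1 + c) I Y z v v' 1"
      using maximal_profile.transform[OF p, of 1 \<eta> 0] \<eta> by (simp add: Y_def[abs_def])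
    moreover have "1 + c > 1 \<or> 1 + c < 0" using c by auto
    ultimately obtain f a0 b0 where "a0 < b0 \<and> is_graph_of (generating_curve Y z) I f {a0<..<b0} \<and>
             single_max_or_min f {a0<..<b0} \<and> bounded (generating_curve Y z ` I) \<and>
             vertical_towards (generating_curve Y z) I a0 \<and> vertical_towards (generating_curve Y z) I b0"
      using maximal_profile.vertical_ends_case[OF _ refl] by blast
    moreover have "eq_up_to_constants \<alpha> I (generating_curve Y z) I"
      unfolding assms(2)
      by (rule eq_up_to_constantsI[of 1 \<eta> _ 0 _ _ 0 _ 0])
         (use \<eta> in \<open>auto simp: generating_curve_def Y_def\<close>)
    ultimately show "\<exists>\<beta> J. eq_up_to_constants \<alpha> I \<beta> J \<and>
          (\<exists>f a0 b0. a0 < b0 \<and> is_graph_of \<beta> J f {a0<..<b0} \<and>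
             single_max_or_min f {a0<..<b0} \<and> bounded (\<beta> ` J) \<and>
             vertical_towards \<beta> J a0 \<and> vertical_towards \<beta> J b0)"
      by blast
  qed
qed

end
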